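(* Let $k \ge 2$ be an integer and let $\mu$ be a planar mass. Then there exist a point $O\in\mathbb{R}^2$ and $3k$ distinct rays $r_0,\dots,r_{3k-1}$ emanating from $O$, listed in counterclockwise order (indices modulo $3k$), such that, writing $V_j$ for the closed sector swept counterclockwise from $r_j$ to $r_{j+1}$, one has $\mu(V_j)=\frac{1}{3k}$ for every $j$, and for every $j$ the union $V_j\cup V_{j+1}\cup\dots\cup V_{j+k}$ of $k+1$ consecutive sectors has angle at most $\pi$ at $O$. In other words, $\mu$ admits a convex $(3k,k+1)$-spiral equicovering.
   Context: A planar mass is a Borel probability measure $\mu$ on $\mathbb{R}^2$ such that $\mu(\ell)=0$ for every affine line $\ell$. Let $1\le p<q$ be integers and let $r_0,\dots,r_{q-1}$ be distinct rays emanating from a point $O$, listed counterclockwise, with indices taken modulo $q$. Let $V_j$ be the closed sector swept counterclockwise from $r_j$ to $r_{j+1}$, and let $W_j=V_j\cup V_{j+1}\cup\dots\cup V_{j+p-1}$. If $\mu(V_j)=1/q$ for every $j$, the family $\{W_j\}_{j=0}^{q-1}$ is called a $(q,p)$-spiral equicovering of $\mu$; it is called convex when all the $W_j$ are convex. Each $W_j$ has a counterclockwise angle $\alpha\in(0,2\pi)$ at $O$ (the angle swept from $r_j$ to $r_{j+p}$), and $W_j$ is convex if and only if $\alpha\le\pi$. *)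

theory Defs
  imports "HOL-Probability.Probability"
begin

definition planar_mass :: "(real^2) measure \<Rightarrow> bool" where
  "planar_mass \<mu> \<longleftrightarrow> prob_space \<mu> \<and> sets \<mu> = sets borel \<and>
     (\<forall>L. affine L \<and> aff_dim L = 1 \<longrightarrow> measure \<mu> L = 0)"

definition dir :: "real \<Rightarrow> real^2" where
  "dir t = vector [cos t, sin t]"

definition ray :: "real^2 \<Rightarrow> real \<Rightarrow> (real^2) set" where
  "ray P t = {P + s *\<^sub>R dir t | s. 0 \<le> s}"

text \<open>The closed sector swept counterclockwise when the polar angle increases from \<open>a\<close> to \<open>b\<close>.\<close>

definition sector :: "real^2 \<Rightarrow> real \<Rightarrow> real \<Rightarrow> (real^2) set" where
  "sector P a b = (\<Union>t\<in>{a..b}. ray P t)"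

text \<open>A counterclockwise list of \<open>q\<close> distinct rays \<open>ray P (\<theta> 0), \<dots>, ray P (\<theta> (q - 1))\<close>
  is encoded by polar angles with \<open>\<theta> 0 < \<dots> < \<theta> (q - 1) < \<theta> 0 + 2 * pi\<close>. Indices modulo \<open>q\<close>
  are handled by lifting the angles: \<open>\<theta>\<close> is defined on all of \<open>nat\<close>, and going up by \<open>q\<close> in the
  index adds one full turn, which gives the same ray.\<close>

definition ccw_angles :: "nat \<Rightarrow> (nat \<Rightarrow> real) \<Rightarrow> bool" where
  "ccw_angles q \<theta> \<longleftrightarrow> strict_mono \<theta> \<and> (\<forall>j. \<theta> (j + q) = \<theta> j + 2 * pi)"

definition spiral_V :: "real^2 \<Rightarrow> (nat \<Rightarrow> real) \<Rightarrow> nat \<Rightarrow> (real^2) set" where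
  "spiral_V P \<theta> j = sector P (\<theta> j) (\<theta> (j + 1))"

definition spiral_W :: "real^2 \<Rightarrow> (nat \<Rightarrow> real) \<Rightarrow> nat \<Rightarrow> nat \<Rightarrow> (real^2) set" where
  "spiral_W P \<theta> p j = (\<Union>i<p. spiral_V P \<theta> (j + i))"

text \<open>The counterclockwise angle of \<open>spiral_W P \<theta> p j\<close> at \<open>P\<close>; see \<open>spiral_W_eq_sector\<close> below.\<close>

definition spiral_angle :: "(nat \<Rightarrow> real) \<Rightarrow> nat \<Rightarrow> nat \<Rightarrow> real" where
  "spiral_angle \<theta> p j = \<theta> (j + p) - \<theta> j"

definition spiral_equicovering ::
    "(real^2) measure \<Rightarrow> nat \<Rightarrow> nat \<Rightarrow> real^2 \<Rightarrow> (nat \<Rightarrow> real) \<Rightarrow> bool" where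
  "spiral_equicovering \<mu> q p P \<theta> \<longleftrightarrow>
     1 \<le> p \<and> p < q \<and> ccw_angles q \<theta> \<and> (\<forall>j. measure \<mu> (spiral_V P \<theta> j) = 1 / real q)"

definition convex_spiral_equicovering ::
    "(real^2) measure \<Rightarrow> nat \<Rightarrow> nat \<Rightarrow> real^2 \<Rightarrow> (nat \<Rightarrow> real) \<Rightarrow> bool" where
  "convex_spiral_equicovering \<mu> q p P \<theta> \<longleftrightarrow>
     spiral_equicovering \<mu> q p P \<theta> \<and> (\<forall>j. convex (spiral_W P \<theta> p j))"

lemma norm_dir: "norm (dir t) = 1"
  by (simp add: dir_def norm_vec_def L2_set_def sum_2)

lemma ray_eq_iff: "ray P a = ray P b \<longleftrightarrow> (\<exists>n::int. a = b + 2 * pi * of_int n)"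
proof
  assume "ray P a = ray P b"
  moreover have "P + 1 *\<^sub>R dir a \<in> ray P a"
    unfolding ray_def using zero_le_one by blast
  ultimately obtain s where s: "0 \<le> s" "P + 1 *\<^sub>R dir a = P + s *\<^sub>R dir b"
    unfolding ray_def by auto
  then have e: "dir a = s *\<^sub>R dir b" by simp
  then have "norm (dir a) = norm (s *\<^sub>R dir b)" by (rule arg_cong)
  with s(1) have "s = 1" by (simp add: norm_dir)
  with e have "dir a = dir b" by simp
  then have "dir a $ 1 = dir b $ 1" "dir a $ 2 = dir b $ 2" by simp_all
  then have "sin a = sin b \<and> cos a = cos b" by (simp add: dir_def)
  then show "\<exists>n::int. a = b + 2 * pi * of_int n" by (simp add: sin_cos_eq_iff)
next
  assume "\<exists>n::int. a = b + 2 * pi * of_int n"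
  then have "sin a = sin b \<and> cos a = cos b" by (simp add: sin_cos_eq_iff)
  then show "ray P a = ray P b" by (simp add: ray_def dir_def)
qed

lemma ccw_angles_distinct_rays:
  assumes "ccw_angles q \<theta>"
  shows "inj_on (\<lambda>j. ray P (\<theta> j)) {..<q}"
proof (rule linorder_inj_onI')
  fix i j assume ij: "i \<in> {..<q}" "j \<in> {..<q}" "i < j"
  have sm: "strict_mono \<theta>" and per: "\<theta> (i + q) = \<theta> i + 2 * pi"
    using assms by (auto simp: ccw_angles_def)
  have "\<theta> i < \<theta> j" using sm ij by (simp add: strict_mono_less)
  moreover have "\<theta> j < \<theta> (i + q)" using sm ij by (simp add: strict_mono_less)
  ultimately have b: "0 < \<theta> j - \<theta> i" "\<theta> j - \<theta> i < 2 * pi" using per by auto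
  show "ray P (\<theta> i) \<noteq> ray P (\<theta> j)"
  proof
    assume "ray P (\<theta> i) = ray P (\<theta> j)"
    then obtain n :: int where n: "\<theta> j = \<theta> i + 2 * pi * of_int n"
      using ray_eq_iff[of P "\<theta> j" "\<theta> i"] by auto
    with b have "0 < 2 * pi * of_int n" "2 * pi * of_int n < 2 * pi * 1" by auto
    then have "0 < real_of_int n" "real_of_int n < 1"
      by (simp_all add: zero_less_mult_iff)
    then show False by simp
  qed
qed

lemma spiral_W_eq_sector:
  assumes "ccw_angles q \<theta>" "1 \<le> p"
  shows "spiral_W P \<theta> p j = sector P (\<theta> j) (\<theta> (j + p))"
  using assms(2)
proof (induction p rule: nat_induct_at_least)
  case base
  then show ?case by (simp add: spiral_W_def spiral_V_def lessThan_Suc)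
next
  case (Suc p)
  have "strict_mono \<theta>" using assms by (simp add: ccw_angles_def)
  then have "\<theta> j \<le> \<theta> (j + p)" "\<theta> (j + p) \<le> \<theta> (j + Suc p)"
    by (auto simp: strict_mono_less_eq)
  then have "{\<theta> j..\<theta> (j + Suc p)} = {\<theta> j..\<theta> (j + p)} \<union> {\<theta> (j + p)..\<theta> (j + Suc p)}"
    by auto
  moreover have "spiral_W P \<theta> (Suc p) j = spiral_W P \<theta> p j \<union> spiral_V P \<theta> (j + p)"
    by (auto simp: spiral_W_def lessThan_Suc)
  ultimately show ?case
    using Suc.IH by (simp add: spiral_V_def sector_def)
qed

end

theory Submission
  imports Defs
begin

text \<open>Measure angles around a point \<open>P\<close> by cumulative mass, scaled so that a full turn is \<open>3k\<close>. A
  position \<open>t\<close> is bad at \<open>P\<close> if advancing by \<open>k + 1\<close> turns through more than \<open>\<pi>\<close>. If for some \<open>P\<close>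
  and \<open>y\<close> no position \<open>y + j\<close> is bad, the rays at these positions are as required. Two bad positions
  at the same point differ by at most \<open>k\<close> modulo \<open>3k\<close>, since otherwise the two sectors would be
  disjoint and their angles would sum to more than \<open>2\<pi>\<close>.

  Suppose every \<open>(P, y)\<close> has a bad \<open>j\<close>. Label a fine grid on (a large square) \<open>\<times> [0, 1]\<close> by bad \<open>j\<close>.
  A small square around which the labels wind carries exactly the labels \<open>i\<close>, \<open>i + k\<close>,
  \<open>i + 2k\<close> modulo \<open>3k\<close>, so the winding number along the boundary of the large square, which is \<open>1\<close>,
  splits into contributions of the \<open>k\<close> classes \<open>i\<close> modulo \<open>k\<close>. These contributions do not depend on
  \<open>y\<close>, while passing from \<open>y = 0\<close> to \<open>y = 1\<close> shifts the classes cyclically; hence they are equal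
  integers with sum \<open>1\<close>, which is impossible for \<open>k \<ge> 2\<close>.\<close>

section \<open>Labellings of a grid by residues\<close>

text \<open>The representative modulo \<open>3 * k\<close> in \<open>{- k..<2 * k}\<close>. On
  differences that are \<open>near\<close> it is the signed shortest step between two
  labels.\<close>

definition wrap :: "int \<Rightarrow> int \<Rightarrow> int" where
  "wrap k x = (x + k) mod (3 * k) - k"

text \<open>On labels modulo \<open>3 * k\<close>: cyclic distance at most \<open>k\<close>.\<close>

definition near :: "int \<Rightarrow> int \<Rightarrow> bool" where
  "near k x \<longleftrightarrow> (x + k) mod (3 * k) \<le> 2 * k"

lemma wrap_cong: "\<exists>m. x = wrap k x + 3 * k * m"
proof -
  have "x + k = 3 * k * ((x + k) div (3 * k)) + (x + k) mod (3 * k)"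
    by (simp only: mult_div_mod_eq)
  then have "x = wrap k x + 3 * k * ((x + k) div (3 * k))" unfolding wrap_def by linarith
  then show ?thesis by blast
qed

lemma near_wrap_bound:
  assumes "k > 0" "near k x"
  shows "\<bar>wrap k x\<bar> \<le> k"
proof -
  have "0 \<le> (x + k) mod (3 * k)" using assms(1) by simp
  then show ?thesis using assms(2) by (auto simp: wrap_def near_def)
qed

lemma multiple_small:
  fixes k m :: int
  assumes "\<bar>3 * k * m\<bar> < 3 * k"
  shows "m = 0"
proof (rule ccontr)
  assume "m \<noteq> 0"
  then have "1 \<le> \<bar>m\<bar>" by simp
  then have "\<bar>3 * k\<bar> * 1 \<le> \<bar>3 * k\<bar> * \<bar>m\<bar>" by (intro mult_left_mono) auto
  moreover have "k > 0" using assms by (smt (verit))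
  ultimately show False using assms by (simp add: abs_mult)
qed

text \<open>Nearness bounds \<open>wrap k x\<close> by \<open>k\<close>, so \<open>wrap k x\<close>
  and \<open>d\<close> are congruent modulo \<open>3 * k\<close> and differ by less than
  \<open>3 * k\<close>.\<close>

lemma wrap_eqI:
  assumes "near k x" "\<bar>d\<bar> < 2 * k" "x = d + 3 * k * m"
  shows "wrap k x = d"
proof -
  obtain n where n: "x = wrap k x + 3 * k * n" using wrap_cong by blast
  have "k > 0" using assms(2) by simp
  then have "\<bar>wrap k x\<bar> \<le> k" using near_wrap_bound assms(1) by simp
  moreover have "3 * k * (n - m) = d - wrap k x" using n assms(3) by (simp add: algebra_simps)
  ultimately have "n - m = 0" using assms(2) by (intro multiple_small[of k]) auto
  then show ?thesis using n assms(3) by simp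
qed

text \<open>If the labels around a square wind nontrivially, some three of them split \<open>\<int>/3k\<close> into
  arcs of length exactly \<open>k\<close>, and no further label is near all three.\<close>

lemma near_index_nonzero_imp_dvd:
  fixes k :: int
  assumes k: "k > 0"
    and near: "\<And>x y. x \<in> S \<Longrightarrow> y \<in> S \<Longrightarrow> near k (y - x)"
    and S: "p \<in> S" "q \<in> S" "r \<in> S" "s \<in> S" "t \<in> S"
    and ind: "wrap k (q - p) + wrap k (r - q) - wrap k (r - s) - wrap k (s - p) \<noteq> 0"
  shows "k dvd t - p"
proof -
  define w where "w x = wrap k (x - p)" for x
  have bnd: "\<bar>w x\<bar> \<le> k" if "x \<in> S" for x
    using near_wrap_bound k near S that by (simp add: w_def)
  have wp: "w p = 0" using k by (simp add: w_def wrap_def)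
  \<comment> \<open>\<open>w\<close> is a potential for the wrapped differences except between the
    values \<open>k\<close> and \<open>- k\<close>: their difference \<open>2 * k\<close> wraps to
    \<open>- k\<close>, its negative to \<open>k\<close>.\<close>
  have diff: "wrap k (y - x) = w y - w x \<and> \<bar>w y - w x\<bar> \<le> k \<or> \<bar>w y - w x\<bar> = 2 * k"
    if "x \<in> S" "y \<in> S" for x y
  proof (cases "\<bar>w y - w x\<bar> = 2 * k")
    case False
    obtain m n where "x - p = w x + 3 * k * m" "y - p = w y + 3 * k * n"
      unfolding w_def using wrap_cong by metis
    then have e: "y - x = (w y - w x) + 3 * k * (n - m)" by (simp add: algebra_simps)
    have "\<bar>w y - w x\<bar> < 2 * k" using False bnd[OF that(1)] bnd[OF that(2)] by linarith
    then have "wrap k (y - x) = w y - w x" using wrap_eqI e near that by blast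
    then show ?thesis using near_wrap_bound[OF k near[OF that]] by simp
  qed simp
  \<comment> \<open>Without such a pair the index would telescope in \<open>w\<close> and
    vanish.\<close>
  have "\<exists>x\<in>S. \<exists>y\<in>S. w x = k \<and> w y = - k"
  proof (rule ccontr)
    assume no: "\<not> ?thesis"
    have "wrap k (y - x) = w y - w x" if "x \<in> S" "y \<in> S" for x y
    proof -
      have "\<bar>w y - w x\<bar> \<noteq> 2 * k"
      proof
        assume "\<bar>w y - w x\<bar> = 2 * k"
        then have "w x = k \<and> w y = - k \<or> w y = k \<and> w x = - k"
          using bnd[OF that(1)] bnd[OF that(2)] by linarith
        then show False using no that by blast
      qed
      then show ?thesis using diff[OF that] by blast
    qed
    then show False using ind S wp by simp
  qed
  then obtain x y where xy: "x \<in> S" "y \<in> S" "w x = k" "w y = - k" by blast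
  have "w t = 0 \<or> w t = k \<or> w t = - k"
    using diff[OF xy(1) S(5)] diff[OF xy(2) S(5)] bnd[OF S(5)] xy by linarith
  then have "k dvd w t" by auto
  moreover obtain m where "t - p = w t + 3 * k * m" unfolding w_def using wrap_cong by blast
  ultimately show ?thesis by simp
qed

text \<open>Replacing each wrapped difference by the plain one changes the sum by a multiple of
  \<open>3 * k\<close>, and the plain differences cancel around the square.\<close>

lemma dvd_index:
  "3 * k dvd wrap k (q - p) + wrap k (r - q) - wrap k (r - s) - wrap k (s - p)"
proof -
  have d: "3 * k dvd x - wrap k x" for x
    using wrap_cong[of x k] by (metis add_diff_cancel_left' dvd_triv_left)
  have "3 * k dvd ((r - s) - wrap k (r - s)) + ((s - p) - wrap k (s - p))
    - ((q - p) - wrap k (q - p)) - ((r - q) - wrap k (r - q))"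
    by (intro dvd_add dvd_diff d)
  then show ?thesis by (simp add: algebra_simps)
qed

text \<open>Counting, for each residue modulo \<open>k\<close>, the indices of the squares in the layer \<open>z\<close> whose
  labels have that residue gives numbers independent of \<open>z\<close>. The shift in the top layer makes the
  \<open>k\<close> numbers equal; they are multiples of \<open>3 * k\<close>, so their sum cannot be \<open>3 * k\<close>.\<close>

lemma no_shifted_labelling:
  fixes lam :: "nat \<Rightarrow> nat \<Rightarrow> nat \<Rightarrow> int" and k :: int and N :: nat
  defines "h \<equiv> \<lambda>a b z. wrap k (lam (Suc a) b z - lam a b z)"
    and "g \<equiv> \<lambda>a b z. wrap k (lam a (Suc b) z - lam a b z)"
    and "u \<equiv> \<lambda>a b z. wrap k (lam a b (Suc z) - lam a b z)"
  defines "ix \<equiv> \<lambda>a b z. g a b z + u a (Suc b) z - g a b (Suc z) - u a b z"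
    and "iy \<equiv> \<lambda>a b z. h a b z + u (Suc a) b z - h a b (Suc z) - u a b z"
  assumes k: "k \<ge> 2"
    and near: "\<And>a b z a' b' z' a'' b'' z''.
      \<lbrakk>a < N; b < N; z < N; a' \<in> {a, Suc a}; b' \<in> {b, Suc b}; z' \<in> {z, Suc z};
        a'' \<in> {a, Suc a}; b'' \<in> {b, Suc b}; z'' \<in> {z, Suc z}\<rbrakk>
      \<Longrightarrow> near k (lam a'' b'' z'' - lam a' b' z')"
    and ix0: "\<And>b z. b < N \<Longrightarrow> z < N \<Longrightarrow> ix 0 b z = 0 \<and> ix N b z = 0"
    and iy0: "\<And>a z. a < N \<Longrightarrow> z < N \<Longrightarrow> iy a 0 z = 0 \<and> iy a N z = 0"
    and seam: "\<And>a b. a \<le> N \<Longrightarrow> b \<le> N \<Longrightarrow> lam a b N = lam a b 0 - 1"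
    and winding: "(\<Sum>a<N. h a 0 0 - h a N 0) + (\<Sum>b<N. g N b 0 - g 0 b 0) = 3 * k"
  shows False
proof -
  \<comment> \<open>\<open>ix\<close>, \<open>iy\<close>, \<open>iz\<close> are the indices of the
    labels around the faces of a grid cube orthogonal to the three axes.\<close>
  define iz where "iz a b z = h a b z + g (Suc a) b z - h a (Suc b) z - g a b z" for a b z
  define chi where "chi i a b z = (if lam a b z mod k = i then 1 else (0::int))" for i a b z
  define T where "T i z = (\<Sum>a<N. \<Sum>b<N. chi i a b z * iz a b z)" for i z
  \<comment> \<open>The signed face indices of a cube cancel edge by edge. If all its labels agree
    modulo \<open>k\<close>, the \<open>chi\<close> are one common factor; otherwise every face
    index is zero.\<close>
  have cube: "chi i a b z * iz a b z - chi i a b (Suc z) * iz a b (Suc z) =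
      (chi i a b z * iy a b z - chi i a (Suc b) z * iy a (Suc b) z)
      + (chi i (Suc a) b z * ix (Suc a) b z - chi i a b z * ix a b z)"
    if *: "a < N" "b < N" "z < N" for i a b z
  proof -
    define S where "S = {lam a' b' z' | a' b' z'.
      a' \<in> {a, Suc a} \<and> b' \<in> {b, Suc b} \<and> z' \<in> {z, Suc z}}"
    have S: "lam a' b' z' \<in> S"
      if "a' \<in> {a, Suc a}" "b' \<in> {b, Suc b}" "z' \<in> {z, Suc z}" for a' b' z'
      using that unfolding S_def by blast
    have nearS: "near k (y - x)" if x: "x \<in> S" and y: "y \<in> S" for x y
    proof -
      obtain a' b' z' where "x = lam a' b' z'" "a' \<in> {a, Suc a}" "b' \<in> {b, Suc b}" "z' \<in> {z, Suc z}"
        using x unfolding S_def mem_Collect_eq by (elim exE conjE) (rule that)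
      moreover obtain a'' b'' z'' where "y = lam a'' b'' z''"
        "a'' \<in> {a, Suc a}" "b'' \<in> {b, Suc b}" "z'' \<in> {z, Suc z}"
        using y unfolding S_def mem_Collect_eq by (elim exE conjE) (rule that)
      ultimately show ?thesis using near[OF *, of a' b' z' a'' b'' z''] by simp
    qed
    have eq: "iz a b z - iz a b (Suc z) = iy a b z + ix (Suc a) b z - iy a (Suc b) z - ix a b z"
      unfolding iz_def ix_def iy_def by simp
    show ?thesis
    proof (cases "\<exists>p\<in>S. \<forall>t\<in>S. k dvd t - p")
      case True
      then obtain p where "\<And>t. t \<in> S \<Longrightarrow> t mod k = p mod k"
        by (metis mod_eq_dvd_iff)
      then have "chi i a' b' z' = (if p mod k = i then 1 else 0)"
        if "a' \<in> {a, Suc a}" "b' \<in> {b, Suc b}" "z' \<in> {z, Suc z}" for a' b' z'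
        using S[OF that] by (simp add: chi_def)
      then show ?thesis using eq by auto
    next
      case False
      have "wrap k (q - p) + wrap k (r - q) - wrap k (r - s) - wrap k (s - p) = 0"
        if "p \<in> S" "q \<in> S" "r \<in> S" "s \<in> S" for p q r s
      proof (rule ccontr)
        assume *: "wrap k (q - p) + wrap k (r - q) - wrap k (r - s) - wrap k (s - p) \<noteq> 0"
        have "k > 0" using k by simp
        then have "k dvd t - p" if "t \<in> S" for t
          by (rule near_index_nonzero_imp_dvd[OF _ nearS \<open>p \<in> S\<close> \<open>q \<in> S\<close> \<open>r \<in> S\<close> \<open>s \<in> S\<close> that *])
        then show False using False \<open>p \<in> S\<close> by blast
      qed
      note * = this
      have "iz a b z = 0" "iz a b (Suc z) = 0" "ix a b z = 0" "ix (Suc a) b z = 0"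
        "iy a b z = 0" "iy a (Suc b) z = 0"
        unfolding iz_def ix_def iy_def h_def g_def u_def
        by (rule *; rule S; simp)+
      then show ?thesis by simp
    qed
  qed
  have tele: "(\<Sum>b<N. f b - f (Suc b)) = f 0 - f N" for f :: "nat \<Rightarrow> int"
    by (rule sum_lessThan_telescope')
  have Tstep: "T i z = T i (Suc z)" if z: "z < N" for i z
  proof -
    have "T i z - T i (Suc z) = (\<Sum>a<N. \<Sum>b<N.
      (chi i a b z * iy a b z - chi i a (Suc b) z * iy a (Suc b) z)
      + (chi i (Suc a) b z * ix (Suc a) b z - chi i a b z * ix a b z))"
      unfolding T_def sum_subtractf[symmetric] using cube z by (intro sum.cong refl) simp
    also have "\<dots> = (\<Sum>a<N. \<Sum>b<N. chi i a b z * iy a b z - chi i a (Suc b) z * iy a (Suc b) z)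
      + (\<Sum>a<N. \<Sum>b<N. chi i (Suc a) b z * ix (Suc a) b z - chi i a b z * ix a b z)"
      by (simp only: sum.distrib)
    \<comment> \<open>Both double sums telescope to indices on opposite sides of the box, which
      vanish by \<open>iy0\<close> and \<open>ix0\<close>.\<close>
    also have "(\<Sum>a<N. \<Sum>b<N. chi i a b z * iy a b z - chi i a (Suc b) z * iy a (Suc b) z) = 0"
    proof (rule sum.neutral, rule ballI)
      show "(\<Sum>b<N. chi i a b z * iy a b z - chi i a (Suc b) z * iy a (Suc b) z) = 0"
        if "a \<in> {..<N}" for a
        using tele[of "\<lambda>b. chi i a b z * iy a b z"] iy0 z that by simp
    qed
    also have "(\<Sum>a<N. \<Sum>b<N. chi i (Suc a) b z * ix (Suc a) b z - chi i a b z * ix a b z) = 0"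
    proof (subst sum.swap, rule sum.neutral, rule ballI)
      show "(\<Sum>a<N. chi i (Suc a) b z * ix (Suc a) b z - chi i a b z * ix a b z) = 0"
        if "b \<in> {..<N}" for b
        using sum_lessThan_telescope[of "\<lambda>a. chi i a b z * ix a b z" N] ix0 z that by simp
    qed
    finally show ?thesis by simp
  qed
  have TN: "T i z = T i 0" if "z \<le> N" for i z
    using that by (induction z) (auto simp: Tstep)
  \<comment> \<open>Lowering all labels by one keeps their differences and moves class
    \<open>i + 1\<close> to class \<open>i\<close>; the bound \<open>i + 1 < k\<close> avoids a
    wraparound of the classes.\<close>
  have seam': "T i N = T (i + 1) 0" if i: "0 \<le> i" "i + 1 < k" for i
  proof -
    have "chi i a b N * iz a b N = chi (i + 1) a b 0 * iz a b 0" if "a < N" "b < N" for a b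
    proof -
      have "iz a b N = iz a b 0" using that by (simp add: iz_def h_def g_def seam)
      moreover have "(lam a b 0 - 1) mod k = i \<longleftrightarrow> lam a b 0 mod k = i + 1"
      proof -
        have "(lam a b 0 - 1) mod k = i mod k \<longleftrightarrow> lam a b 0 mod k = (i + 1) mod k"
          by (simp add: mod_eq_dvd_iff algebra_simps)
        then show ?thesis using i by simp
      qed
      ultimately show ?thesis using that by (simp add: chi_def seam)
    qed
    then show ?thesis unfolding T_def by (intro sum.cong refl) simp
  qed
  have Teq: "T (int i) 0 = T 0 0" if "int i < k" for i
    using that
  proof (induction i)
    case (Suc i)
    then have "T (int i) 0 = T 0 0" "T (int i) N = T (int i + 1) 0" by (auto intro: seam')
    then show ?case using TN[of N "int i"] by (simp add: add.commute)
  qed simp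
  have Teq': "T i 0 = T 0 0" if "i \<in> {0..<k}" for i
    using Teq[of "nat i"] that by simp
  have "(\<Sum>i\<in>{0..<k}. T i 0) = (\<Sum>a<N. \<Sum>b<N. \<Sum>i\<in>{0..<k}. chi i a b 0 * iz a b 0)"
    unfolding T_def by (subst sum.swap, intro sum.cong refl, rule sum.swap)
  also have "\<dots> = (\<Sum>a<N. \<Sum>b<N. iz a b 0)"
    using k by (simp add: chi_def sum_distrib_right[symmetric])
  also have "\<dots> = (\<Sum>a<N. \<Sum>b<N. (h a b 0 - h a (Suc b) 0) + (g (Suc a) b 0 - g a b 0))"
    by (simp add: iz_def algebra_simps)
  also have "\<dots> = (\<Sum>a<N. \<Sum>b<N. h a b 0 - h a (Suc b) 0)
      + (\<Sum>b<N. \<Sum>a<N. g (Suc a) b 0 - g a b 0)"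
    unfolding sum.distrib by (intro arg_cong2[of _ _ _ _ "(+)"] refl sum.swap)
  also have "\<dots> = 3 * k"
  proof -
    have "(\<Sum>b<N. h a b 0 - h a (Suc b) 0) = h a 0 0 - h a N 0" for a by (rule tele)
    moreover have "(\<Sum>a<N. g (Suc a) b 0 - g a b 0) = g N b 0 - g 0 b 0" for b
      by (rule sum_lessThan_telescope)
    ultimately show ?thesis using winding by (simp only:)
  qed
  finally have "(\<Sum>i\<in>{0..<k}. T i 0) = 3 * k" .
  moreover have "(\<Sum>i\<in>{0..<k}. T i 0) = (\<Sum>i\<in>{0..<k}. T 0 0)"
    by (rule sum.cong[OF refl Teq'])
  ultimately have "(\<Sum>i\<in>{0..<k}. T 0 0) = 3 * k" by simp
  then have "k * T 0 0 = k * 3" using k by simp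
  then have "T 0 0 = 3" using k by simp
  moreover have "3 * k dvd T 0 0"
    unfolding T_def iz_def h_def g_def by (intro dvd_sum dvd_mult dvd_index)
  ultimately have "3 * k \<le> 3" by (metis zdvd_imp_le zero_less_numeral)
  then show False using k by simp
qed

section \<open>Positions where the angle is too large\<close>

text \<open>One modulus of continuity per parameter yields a common one by taking minima. It is
  applied to the four outward directions of a square.\<close>

lemma finite_uniform_modulus:
  fixes f :: "'a::metric_space \<Rightarrow> 'b \<Rightarrow> real"
  assumes "finite A" "compact K" "\<And>t. continuous_on K (\<lambda>P. f P t)" "c > 0"
  shows "\<exists>d>0. \<forall>t\<in>A. \<forall>P\<in>K. \<forall>Q\<in>K. dist P Q < d \<longrightarrow> \<bar>f P t - f Q t\<bar> < c"
  using assms(1)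
proof induction
  case empty
  then show ?case by (auto intro: exI[of _ 1])
next
  case (insert t A)
  then obtain d where d: "d > 0"
    "\<And>s P Q. s \<in> A \<Longrightarrow> P \<in> K \<Longrightarrow> Q \<in> K \<Longrightarrow> dist P Q < d \<Longrightarrow> \<bar>f P s - f Q s\<bar> < c"
    by blast
  have "uniformly_continuous_on K (\<lambda>P. f P t)"
    using assms compact_uniformly_continuous by blast
  then obtain d' where d': "d' > 0"
    "\<And>P Q. P \<in> K \<Longrightarrow> Q \<in> K \<Longrightarrow> dist P Q < d' \<Longrightarrow> \<bar>f P t - f Q t\<bar> < c"
    using \<open>c > 0\<close> unfolding uniformly_continuous_on_def dist_real_def by metis
  show ?case
    by (rule exI[of _ "min d d'"]) (use d d' in auto)
qed

text \<open>Collects what the topological argument uses: \<open>F P a\<close> stands for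
  \<open>3 * k\<close> times the mass swept at \<open>P\<close> up to polar angle \<open>a\<close>.
  By \<open>F_far\<close>, the half-plane facing outward from a remote point carries little
  mass.\<close>

locale turning_mass =
  fixes F :: "real^2 \<Rightarrow> real \<Rightarrow> real" and k :: int
  assumes k2: "k \<ge> 2"
    and F_mono: "a \<le> b \<Longrightarrow> F P a \<le> F P b"
    and F_turn: "F P (a + 2 * pi) = F P a + 3 * of_int k"
    and F_cont: "continuous_on UNIV (\<lambda>P. F P a)"
    and F_far: "\<exists>R>0. \<forall>P \<psi>. R \<le> P \<bullet> dir \<psi> \<longrightarrow> F P (\<psi> + pi / 2) - F P (\<psi> - pi / 2) \<le> 1 / 8"
begin

text \<open>When \<open>F P\<close> is strictly increasing this says that the rays with cumulative masses \<open>t\<close> and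
  \<open>t + k + 1\<close> enclose an angle larger than \<open>pi\<close>. This form is open in \<open>(P, t)\<close> without any
  choice of rays, so masses with gaps in their support need no separate treatment.\<close>

definition bad :: "real^2 \<Rightarrow> real \<Rightarrow> bool" where
  "bad P t \<longleftrightarrow> (\<exists>\<phi>. t < F P \<phi> \<and> F P (\<phi> + pi) < t + of_int k + 1)"

lemma F_turns: "F P (a + 2 * pi * of_int m) = F P a + 3 * of_int k * of_int m"
proof (induction m rule: int_induct[where k = 0])
  case (step1 i)
  then show ?case using F_turn[of P "a + 2 * pi * of_int i"] by (simp add: algebra_simps)
next
  case (step2 i)
  then show ?case using F_turn[of P "a + 2 * pi * of_int (i - 1)"] by (simp add: algebra_simps)
qed simp

lemma bad_add_turns:
  assumes "bad P t"
  shows "bad P (t + 3 * of_int k * of_int m)"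
proof -
  obtain a where "t < F P a" "F P (a + pi) < t + of_int k + 1"
    using assms bad_def by blast
  then have "t + 3 * of_int k * of_int m < F P (a + 2 * pi * of_int m)"
    "F P (a + 2 * pi * of_int m + pi) < t + 3 * of_int k * of_int m + of_int k + 1"
    using F_turns[of P a m] F_turns[of P "a + pi" m] by (simp_all add: algebra_simps)
  then show ?thesis using bad_def by blast
qed

lemma bad_imp_near:
  assumes "bad P t" "bad P (t + of_int s)"
  shows "near k s"
proof -
  define r where "r = s mod (3 * k)"
  have r: "0 \<le> r" "r < 3 * k" using k2 by (simp_all add: r_def)
  have "s = r + 3 * k * (s div (3 * k))" by (simp add: r_def)
  then have "real_of_int s = of_int r + 3 * of_int k * of_int (s div (3 * k))"
    by (metis of_int_add of_int_mult of_int_numeral)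
  then have "bad P (t + of_int r)"
    using bad_add_turns[OF assms(2), of "- (s div (3 * k))"] by simp
  then obtain b where b: "t + of_int r < F P b" "F P (b + pi) < t + of_int r + of_int k + 1"
    using bad_def by blast
  obtain a where a: "t < F P a" "F P (a + pi) < t + of_int k + 1"
    using assms(1) bad_def by blast
  have "r \<le> k \<or> 2 * k \<le> r"
  proof (rule ccontr)
    assume "\<not> ?thesis"
    then have "k + 1 \<le> r" "r + 1 \<le> 2 * k" by simp_all
    then have rr: "real_of_int k + 1 \<le> of_int r" "real_of_int r + 1 \<le> 2 * of_int k" by linarith+
    \<comment> \<open>Because \<open>r + k + 1 \<le> 3 * k\<close>, the half turn from
      \<open>b\<close> ends before the full turn from \<open>a\<close>. Hence
      \<open>b < a + pi\<close>, which bounds \<open>t + r\<close> by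
      \<open>t + k + 1 \<le> t + r\<close> strictly.\<close>
    have "F P (b + pi) < F P (a + 2 * pi)" using a b rr F_turn[of P a] by linarith
    then have "b + pi < a + 2 * pi" using F_mono not_less by blast
    then have "F P b \<le> F P (a + pi)" by (intro F_mono) simp
    then show False using a b rr by linarith
  qed
  moreover have "(s + k) mod (3 * k) = (r + k) mod (3 * k)"
    by (simp add: r_def mod_add_left_eq)
  moreover have "(r + k) mod (3 * k) = (if r < 2 * k then r + k else r - 2 * k)"
  proof (cases "r < 2 * k")
    case False
    have "(r - 2 * k + 3 * k) mod (3 * k) = (r - 2 * k) mod (3 * k)" by (rule mod_add_self2)
    moreover have "r - 2 * k + 3 * k = r + k" by simp
    moreover have "(r - 2 * k) mod (3 * k) = r - 2 * k"
      using r False by (intro mod_pos_pos_trivial) auto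
    ultimately show ?thesis using False by simp
  qed (use r in \<open>simp add: mod_pos_pos_trivial\<close>)
  ultimately show ?thesis using r k2 by (auto simp: near_def)
qed

lemma open_bad: "open {x. bad (fst x) (snd x + c)}"
proof -
  have cont: "continuous_on UNIV (\<lambda>x::(real^2) \<times> real. F (fst x) a)" for a
    by (rule continuous_on_compose2[OF F_cont continuous_on_fst[OF continuous_on_id]]) auto
  have "{x. bad (fst x) (snd x + c)} = (\<Union>a. {x. snd x + c < F (fst x) a}
      \<inter> {x. F (fst x) (a + pi) < snd x + c + of_int k + 1})"
    by (auto simp: bad_def)
  also have "open \<dots>"
    by (intro open_UN open_Int ballI open_Collect_less cont continuous_intros)
  finally show ?thesis .
qed

section \<open>Integer lifts of labels at remote points\<close>

definition far :: "real^2 \<Rightarrow> real \<Rightarrow> bool" where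
  "far P \<psi> \<longleftrightarrow> F P (\<psi> + pi / 2) - F P (\<psi> - pi / 2) \<le> 1 / 8"

text \<open>Here \<open>E\<close> is the cumulative mass in an outward direction, measured from
  \<open>y\<close>. The range \<open>- (k + 1) < l - E < 0\<close> is widened at both ends by 1/8,
  the mass that \<open>far\<close> tolerates.\<close>

definition in_window :: "real \<Rightarrow> int \<Rightarrow> bool" where
  "in_window E l \<longleftrightarrow> E - of_int k - 9 / 8 < of_int l \<and> of_int l < E + 1 / 8"

text \<open>The representative of \<open>j\<close> modulo \<open>3 * k\<close> that lies in the window, provided there is one.\<close>

definition window_lift :: "real \<Rightarrow> int \<Rightarrow> int" where
  "window_lift E j = j + 3 * k * \<lfloor>(E + 1 / 8 - of_int j) / (3 * of_int k)\<rfloor>"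

lemma window_lift_cong: "\<exists>m. window_lift E j = j + 3 * k * m"
  by (auto simp: window_lift_def)

lemma window_lift_add: "window_lift (E + 3 * of_int k) j = window_lift E j + 3 * k"
proof -
  have "(E + 3 * of_int k + 1 / 8 - of_int j) / (3 * of_int k)
      = (E + 1 / 8 - of_int j) / (3 * of_int k) + 1"
    using k2 by (simp add: field_simps)
  then show ?thesis by (simp add: window_lift_def algebra_simps)
qed

text \<open>Full turns move the half turn \<open>[a, a + pi]\<close> witnessing badness until it
  meets the half turn centred at \<psi>. There \<open>F P\<close> stays within 1/8 of
  \<open>F P \<psi>\<close>, so the two inequalities of \<open>bad\<close> become the window bounds.
  The window is shorter than \<open>3 * k\<close>, so the floor picks exactly this lift.\<close>

lemma bad_window:
  assumes "far P \<psi>" "bad P (y + of_int j)"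
  shows "in_window (F P \<psi> - y) (window_lift (F P \<psi> - y) j)"
proof -
  define t where "t = y + of_int j"
  obtain a where a: "t < F P a" "F P (a + pi) < t + of_int k + 1"
    using assms(2) bad_def t_def by blast
  define m where "m = \<lfloor>(\<psi> + pi / 2 - a) / (2 * pi)\<rfloor>"
  have "of_int m \<le> (\<psi> + pi / 2 - a) / (2 * pi)" "(\<psi> + pi / 2 - a) / (2 * pi) < of_int m + 1"
    unfolding m_def by linarith+
  then have m: "a + 2 * pi * of_int m \<le> \<psi> + pi / 2" "\<psi> - pi / 2 \<le> a + 2 * pi * of_int m + pi"
    by (simp_all add: field_simps)
  have "t + 3 * of_int k * of_int m < F P \<psi> + 1 / 8"
    using F_mono[OF m(1), of P] F_turns[of P a m] a(1) F_mono[of "\<psi> - pi / 2" \<psi> P] assms(1)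
    unfolding far_def by simp
  moreover have "F P \<psi> - 1 / 8 < t + 3 * of_int k * of_int m + of_int k + 1"
    using F_mono[OF m(2), of P] F_turns[of P "a + pi" m] a(2) F_mono[of \<psi> "\<psi> + pi / 2" P] assms(1)
    unfolding far_def by (simp add: algebra_simps)
  moreover define E where "E = F P \<psi> - y"
  ultimately have w: "in_window E (j + 3 * k * m)"
    by (simp add: in_window_def t_def algebra_simps)
  then have "of_int m * (3 * of_int k) \<le> E + 1 / 8 - of_int j"
    "E + 1 / 8 - of_int j < (of_int m + 1) * (3 * of_int k)"
    using k2 by (simp_all add: in_window_def algebra_simps)
  then have "\<lfloor>(E + 1 / 8 - of_int j) / (3 * of_int k)\<rfloor> = m"
    using k2 by (intro floor_unique) (simp_all add: field_simps)
  then show ?thesis using w by (simp add: window_lift_def E_def)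
qed

text \<open>The window has length \<open>k + 5/4\<close> and moves by at most 1/4, so the integers
  differ by at most \<open>k + 1\<close>, which is below \<open>2 * k\<close> since
  \<open>k \<ge> 2\<close>.\<close>

lemma in_window_diff:
  assumes "in_window E l" "in_window E' l'" "\<bar>E' - E\<bar> \<le> 1 / 4"
  shows "\<bar>l' - l\<bar> < 2 * k"
proof -
  have "\<bar>real_of_int (l' - l)\<bar> < of_int k + 2" using assms unfolding in_window_def of_int_diff by linarith
  then have "\<bar>l' - l\<bar> < k + 2" by linarith
  then show ?thesis using k2 by linarith
qed

text \<open>Turns wrapped differences into differences of integer lifts, so that sums along a side
  of the large square telescope.\<close>

lemma wrap_window_lift:
  assumes "near k (j' - j)" "in_window E (window_lift E j)" "in_window E' (window_lift E' j')"
    "\<bar>E' - E\<bar> \<le> 1 / 4"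
  shows "wrap k (j' - j) = window_lift E' j' - window_lift E j"
proof -
  obtain m m' where "window_lift E j = j + 3 * k * m" "window_lift E' j' = j' + 3 * k * m'"
    using window_lift_cong by metis
  then have "j' - j = window_lift E' j' - window_lift E j + 3 * k * (m - m')"
    by (simp add: algebra_simps)
  then show ?thesis using in_window_diff assms by (intro wrap_eqI) auto
qed

lemma window_lift_eq:
  assumes "in_window E (window_lift E j)" "in_window E' (window_lift E' j)" "\<bar>E' - E\<bar> \<le> 1 / 4"
  shows "window_lift E' j = window_lift E j"
  using wrap_window_lift[of j j E E'] assms k2 by (simp add: wrap_def near_def)

section \<open>Contradiction from a labelled grid\<close>

lemma exists_not_bad: "\<exists>P y. \<forall>j::int. \<not> bad P (y + of_int j)"
proof (rule ccontr)
  assume "\<not> ?thesis"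
  then have all_bad: "\<exists>j::int. bad P (y + of_int j)" for P y by blast
  obtain R where R: "R > 0" and far: "\<And>P \<psi>. R \<le> P \<bullet> dir \<psi> \<Longrightarrow> far P \<psi>"
    using F_far unfolding far_def by blast
  define B where "B j = {x. bad (fst x) (snd x + of_int j)}" for j :: int
  have cK: "compact (cball (0::real^2) (2 * R) \<times> {0..1::real})"
    by (intro compact_Times) auto
  have cover: "cball (0::real^2) (2 * R) \<times> {0..1::real} \<subseteq> \<Union> (range B)"
    using all_bad by (auto simp: B_def)
  have "open G" if "G \<in> range B" for G using that open_bad by (auto simp: B_def)
  \<comment> \<open>\<open>e\<close> is a Lebesgue number: around each point some single label stays
    bad on the whole ball of radius \<open>e\<close>.\<close>
  then obtain e where e: "e > 0"
    "\<And>x. x \<in> cball (0::real^2) (2 * R) \<times> {0..1} \<Longrightarrow> \<exists>j. ball x e \<subseteq> B j"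
    using Heine_Borel_lemma[OF cK cover] by (smt (verit) imageE)
  \<comment> \<open>The outward directions of the bottom, right, top and left sides of the
    square.\<close>
  define A where "A = {- pi / 2, 0, pi / 2, pi}"
  have "\<exists>d>0. \<forall>t\<in>A. \<forall>P\<in>cball 0 (2 * R). \<forall>Q\<in>cball 0 (2 * R).
      dist P Q < d \<longrightarrow> \<bar>F P t - F Q t\<bar> < 1 / 4"
    by (rule finite_uniform_modulus) (auto simp: A_def intro: continuous_on_subset[OF F_cont])
  then obtain d where d: "d > 0" "\<And>t P Q. t \<in> A \<Longrightarrow> P \<in> cball 0 (2 * R) \<Longrightarrow> Q \<in> cball 0 (2 * R)
      \<Longrightarrow> dist P Q < d \<Longrightarrow> \<bar>F P t - F Q t\<bar> < 1 / 4"
    by blast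
  \<comment> \<open>Neighbouring grid points differ by at most \<open>2 * R / N\<close> in each
    plane coordinate and \<open>1 / N\<close> in height, in total
    \<open>(4 * R + 1) / N\<close>.\<close>
  obtain N :: nat where N: "(4 * R + 1) / min e d < N"
    using reals_Archimedean2 by blast
  have "0 < (4 * R + 1) / min e d" using R e d by simp
  then have N0: "N > 0" using N by (cases N) auto
  have step: "(4 * R + 1) / N < e" "(4 * R + 1) / N < d"
  proof -
    have "4 * R + 1 < N * min e d" using N e(1) d(1) by (simp add: divide_less_eq)
    moreover have "N * min e d \<le> N * e" "N * min e d \<le> N * d" by (auto intro: mult_left_mono)
    ultimately have "4 * R + 1 < N * e" "4 * R + 1 < N * d" by linarith+
    then show "(4 * R + 1) / N < e" "(4 * R + 1) / N < d"
      using N0 by (simp_all add: divide_less_eq mult.commute)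
  qed
  define c where "c a = - R + 2 * R * real a / N" for a :: nat
  define pt where "pt a b = (vector [c a, c b] :: real^2)" for a b :: nat
  have pt_nth: "pt a b $ 1 = c a" "pt a b $ 2 = c b" for a b by (simp_all add: pt_def)
  have c_bound: "\<bar>c a\<bar> \<le> R" if "a \<le> N" for a
  proof -
    have "2 * R * real a \<le> 2 * R * N" using that R by simp
    then have "2 * R * real a / N \<le> 2 * R" using N0 by (simp add: field_simps)
    then show ?thesis using R by (simp add: c_def abs_le_iff)
  qed
  have norm_le: "norm x \<le> \<bar>x $ 1\<bar> + \<bar>x $ 2\<bar>" for x :: "real^2"
    using norm_le_l1_cart[of x] by (simp add: sum_2)
  have ptK: "pt a b \<in> cball 0 (2 * R)" if "a \<le> N" "b \<le> N" for a b
    using norm_le[of "pt a b"] c_bound[OF that(1)] c_bound[OF that(2)] by (simp add: pt_nth)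
  have c_dist: "\<bar>c a - c a'\<bar> \<le> 2 * R / N" if "a \<le> Suc a'" "a' \<le> Suc a" for a a'
  proof -
    have "\<bar>real a - real a'\<bar> \<le> 1" using that by linarith
    then have "2 * R / N * \<bar>real a - real a'\<bar> \<le> 2 * R / N * 1"
      using R by (intro mult_left_mono) auto
    moreover have "c a - c a' = 2 * R / N * (real a - real a')"
      by (simp add: c_def algebra_simps diff_divide_distrib)
    ultimately show ?thesis using R by (simp add: abs_mult)
  qed
  have pt_dist: "dist (pt a b) (pt a' b') \<le> 4 * R / N"
    if "a \<le> Suc a'" "a' \<le> Suc a" "b \<le> Suc b'" "b' \<le> Suc b" for a a' b b'
    using norm_le[of "pt a b - pt a' b'"] c_dist[OF that(1,2)] c_dist[OF that(3,4)]
    by (simp add: dist_norm pt_nth)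
  define lam0 where "lam0 a b z = (SOME j. ball (pt a b, real z / N) e \<subseteq> B j)" for a b z :: nat
  \<comment> \<open>The top layer is not chosen anew but copied from the bottom one:
    \<open>j\<close> is bad at height 0 iff \<open>j - 1\<close> is bad at height 1. This makes the
    seam condition exact.\<close>
  define lam where "lam a b z = (if z = N then lam0 a b 0 - 1 else lam0 a b z)" for a b z
  have lam0: "ball (pt a b, real z / N) e \<subseteq> B (lam0 a b z)" if "a \<le> N" "b \<le> N" "z \<le> N" for a b z
  proof -
    have "(pt a b, real z / N) \<in> cball (0::real^2) (2 * R) \<times> {0..1}"
      using ptK[OF that(1,2)] that(3) N0 by simp
    then show ?thesis unfolding lam0_def by (rule someI_ex[OF e(2)])
  qed
  have lam: "ball (pt a b, real z / N) e \<subseteq> B (lam a b z)" if *: "a \<le> N" "b \<le> N" "z \<le> N" for a b z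
  proof (cases "z = N")
    case True
    show ?thesis
    proof
      fix x assume "x \<in> ball (pt a b, real z / N) e"
      then have "(fst x, snd x - 1) \<in> ball (pt a b, real 0 / N) e"
        using N0 True by (cases x) (simp add: dist_Pair_Pair dist_real_def)
      then have "(fst x, snd x - 1) \<in> B (lam0 a b 0)" using lam0[of a b 0] * by blast
      then show "x \<in> B (lam a b z)" by (simp add: B_def lam_def True algebra_simps)
    qed
  qed (use lam0[OF *] in \<open>simp add: lam_def\<close>)
  \<comment> \<open>A label remains bad at every adjacent grid point. All labels of a cube are
    therefore bad for one common point and offset, hence pairwise near.\<close>
  have adj: "bad (pt a b) (real z / N + of_int (lam a' b' z'))"
    if "a' \<le> N" "b' \<le> N" "z' \<le> N" "a \<le> Suc a'" "a' \<le> Suc a" "b \<le> Suc b'" "b' \<le> Suc b"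
      "z \<le> Suc z'" "z' \<le> Suc z" for a b z a' b' z'
  proof -
    have "\<bar>real z - real z'\<bar> \<le> 1" using that by linarith
    then have "\<bar>real z - real z'\<bar> / N \<le> 1 / N" by (intro divide_right_mono) auto
    then have "dist (real z / N) (real z' / N) \<le> 1 / N"
      using N0 by (simp add: dist_real_def diff_divide_distrib[symmetric])
    moreover have "dist (pt a b, real z / N) (pt a' b', real z' / N)
        \<le> dist (pt a b) (pt a' b') + dist (real z / N) (real z' / N)"
      unfolding dist_Pair_Pair by (rule sqrt_sum_squares_le_sum) auto
    moreover have "dist (pt a b) (pt a' b') \<le> 4 * R / N" using pt_dist that by blast
    moreover have "4 * R / N + 1 / N = (4 * R + 1) / N" by (simp add: add_divide_distrib)
    ultimately have "(pt a b, real z / N) \<in> ball (pt a' b', real z' / N) e"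
      using step(1) by (simp add: dist_commute)
    then show ?thesis using lam[of a' b' z'] that by (auto simp: B_def)
  qed
  have near: "near k (lam a'' b'' z'' - lam a' b' z')"
    if "bad P (y + of_int (lam a' b' z'))" "bad P (y + of_int (lam a'' b'' z''))"
    for P y a' b' z' a'' b'' z''
    using bad_imp_near[OF that(1), of "lam a'' b'' z'' - lam a' b' z'"] that(2)
    by (simp add: algebra_simps)
  \<comment> \<open>All labels of a vertical face on a side are lifted at a single point and height,
    so their differences cancel around the face.\<close>
  have side: "wrap k (lam a'' b'' z'' - lam a' b' z')
      = window_lift (F (pt a b) \<psi> - real z / N) (lam a'' b'' z'')
        - window_lift (F (pt a b) \<psi> - real z / N) (lam a' b' z')"
    if "far (pt a b) \<psi>" "bad (pt a b) (real z / N + of_int (lam a' b' z'))"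
      "bad (pt a b) (real z / N + of_int (lam a'' b'' z''))" for a b z a' b' z' a'' b'' z'' \<psi>
    using wrap_window_lift[OF near[OF that(2,3)] bad_window[OF that(1,2)] bad_window[OF that(1,3)]]
    by simp
  have cN: "c 0 = - R" "c N = R" using N0 by (simp_all add: c_def)
  have dirs: "dir (- pi / 2) = vector [0, -1]" "dir 0 = vector [1, 0]"
    "dir (pi / 2) = vector [0, 1]" "dir pi = vector [-1, 0]"
    by (simp_all add: dir_def)
  have dir3: "dir (3 / 2 * pi) = vector [0, -1]"
    unfolding dir_def cos_3over2_pi sin_3over2_pi by simp
  have farN: "far (pt a 0) (- pi / 2)" "far (pt N b) 0" "far (pt a N) (pi / 2)" "far (pt 0 b) pi"
    "far (pt a 0) (3 / 2 * pi)" for a b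
    by (rule far; simp only: dirs dir3; simp add: inner_vec_def sum_2 pt_nth cN)+
  define l where "l \<psi> a b = window_lift (F (pt a b) \<psi>) (lam a b 0)" for \<psi> a b
  have edge: "wrap k (lam a' b' 0 - lam a b 0) = l \<psi> a' b' - l \<psi> a b"
    if "\<psi> \<in> A" "far (pt a b) \<psi>" "far (pt a' b') \<psi>" "a \<le> N" "b \<le> N" "a' \<le> N" "b' \<le> N"
      "a \<le> Suc a'" "a' \<le> Suc a" "b \<le> Suc b'" "b' \<le> Suc b" for \<psi> a b a' b'
  proof -
    have bad: "bad (pt a b) (0 + of_int (lam a b 0))" "bad (pt a b) (0 + of_int (lam a' b' 0))"
      "bad (pt a' b') (0 + of_int (lam a' b' 0))"
      using adj[of a b 0 a b 0] adj[of a' b' 0 a b 0] adj[of a' b' 0 a' b' 0] that by auto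
    have "4 * R / N \<le> (4 * R + 1) / N" using N0 by (simp add: divide_right_mono)
    then have "dist (pt a' b') (pt a b) < d"
      using pt_dist[of a' a b' b] that step(2) by linarith
    then have "\<bar>F (pt a' b') \<psi> - F (pt a b) \<psi>\<bar> \<le> 1 / 4"
      using d(2)[OF \<open>\<psi> \<in> A\<close> ptK ptK] that by (simp add: less_imp_le)
    then show ?thesis unfolding l_def
      using wrap_window_lift[OF near[OF bad(1,2)]] bad_window[OF that(2) bad(1)]
        bad_window[OF that(3) bad(3)] by simp
  qed
  \<comment> \<open>A corner is far in both adjacent outward directions, and \<open>F\<close>
    changes by at most 1/8 between them, so switching direction keeps the lift.\<close>
  have corner: "l (\<psi> + pi / 2) a b = l \<psi> a b"
    if "far (pt a b) \<psi>" "far (pt a b) (\<psi> + pi / 2)" "a \<le> N" "b \<le> N" for \<psi> a b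
  proof -
    have bad: "bad (pt a b) (0 + of_int (lam a b 0))" using adj[of a b 0 a b 0] that by auto
    have "F (pt a b) (\<psi> - pi / 2) \<le> F (pt a b) \<psi>" "F (pt a b) \<psi> \<le> F (pt a b) (\<psi> + pi / 2)"
      by (auto intro: F_mono)
    then have "\<bar>F (pt a b) (\<psi> + pi / 2) - F (pt a b) \<psi>\<bar> \<le> 1 / 4"
      using that(1) unfolding far_def by linarith
    then show ?thesis unfolding l_def
      using window_lift_eq bad_window[OF that(1) bad] bad_window[OF that(2) bad] by simp
  qed
  show False
  proof (rule no_shifted_labelling[where N = N and lam = lam, OF k2])
    fix a b z a' b' z' a'' b'' z''
    assume "a < N" "b < N" "z < N" "a' \<in> {a, Suc a}" "b' \<in> {b, Suc b}" "z' \<in> {z, Suc z}"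
        "a'' \<in> {a, Suc a}" "b'' \<in> {b, Suc b}" "z'' \<in> {z, Suc z}"
    then show "near k (lam a'' b'' z'' - lam a' b' z')"
      using adj[of a' b' z' a b z] adj[of a'' b'' z'' a b z] by (intro near[of "pt a b" "real z / N"]) auto
  next
    fix b z assume bz: "b < N" "z < N"
    have "wrap k (lam a (Suc b) z - lam a b z) + wrap k (lam a (Suc b) (Suc z) - lam a (Suc b) z)
        - wrap k (lam a (Suc b) (Suc z) - lam a b (Suc z)) - wrap k (lam a b (Suc z) - lam a b z) = 0"
      if "far (pt a b) \<psi>" "a \<le> N" for a \<psi>
      using that bz by (simp add: side[OF that(1) adj[where z = z] adj[where z = z]])
    then show "wrap k (lam 0 (Suc b) z - lam 0 b z) + wrap k (lam 0 (Suc b) (Suc z) - lam 0 (Suc b) z)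
        - wrap k (lam 0 (Suc b) (Suc z) - lam 0 b (Suc z)) - wrap k (lam 0 b (Suc z) - lam 0 b z) = 0 \<and>
      wrap k (lam N (Suc b) z - lam N b z) + wrap k (lam N (Suc b) (Suc z) - lam N (Suc b) z)
        - wrap k (lam N (Suc b) (Suc z) - lam N b (Suc z)) - wrap k (lam N b (Suc z) - lam N b z) = 0"
      using farN by blast
  next
    fix a z assume az: "a < N" "z < N"
    have "wrap k (lam (Suc a) b z - lam a b z) + wrap k (lam (Suc a) b (Suc z) - lam (Suc a) b z)
        - wrap k (lam (Suc a) b (Suc z) - lam a b (Suc z)) - wrap k (lam a b (Suc z) - lam a b z) = 0"
      if "far (pt a b) \<psi>" "b \<le> N" for b \<psi>
      using that az by (simp add: side[OF that(1) adj[where z = z] adj[where z = z]])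
    then show "wrap k (lam (Suc a) 0 z - lam a 0 z) + wrap k (lam (Suc a) 0 (Suc z) - lam (Suc a) 0 z)
        - wrap k (lam (Suc a) 0 (Suc z) - lam a 0 (Suc z)) - wrap k (lam a 0 (Suc z) - lam a 0 z) = 0 \<and>
      wrap k (lam (Suc a) N z - lam a N z) + wrap k (lam (Suc a) N (Suc z) - lam (Suc a) N z)
        - wrap k (lam (Suc a) N (Suc z) - lam a N (Suc z)) - wrap k (lam a N (Suc z) - lam a N z) = 0"
      using farN by blast
  next
    show "lam a b N = lam a b 0 - 1" for a b using N0 by (simp add: lam_def)
  next
    have "(\<Sum>a<N. wrap k (lam (Suc a) 0 0 - lam a 0 0)) = (\<Sum>a<N. l (- pi / 2) (Suc a) 0 - l (- pi / 2) a 0)"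
      "(\<Sum>a<N. wrap k (lam (Suc a) N 0 - lam a N 0)) = (\<Sum>a<N. l (pi / 2) (Suc a) N - l (pi / 2) a N)"
      "(\<Sum>b<N. wrap k (lam N (Suc b) 0 - lam N b 0)) = (\<Sum>b<N. l 0 N (Suc b) - l 0 N b)"
      "(\<Sum>b<N. wrap k (lam 0 (Suc b) 0 - lam 0 b 0)) = (\<Sum>b<N. l pi 0 (Suc b) - l pi 0 b)"
      by (intro sum.cong refl edge farN; simp add: A_def)+
    then have sums: "(\<Sum>a<N. wrap k (lam (Suc a) 0 0 - lam a 0 0)) = l (- pi / 2) N 0 - l (- pi / 2) 0 0"
      "(\<Sum>a<N. wrap k (lam (Suc a) N 0 - lam a N 0)) = l (pi / 2) N N - l (pi / 2) 0 N"
      "(\<Sum>b<N. wrap k (lam N (Suc b) 0 - lam N b 0)) = l 0 N N - l 0 N 0"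
      "(\<Sum>b<N. wrap k (lam 0 (Suc b) 0 - lam 0 b 0)) = l pi 0 N - l pi 0 0"
      by (simp_all only: sum_lessThan_telescope sum_lessThan_telescope[of "\<lambda>a. l \<psi> a b" for \<psi> b])
    have "l 0 N 0 = l (- pi / 2) N 0" using corner[of N 0 "- pi / 2"] farN by simp
    moreover have "l (pi / 2) N N = l 0 N N" using corner[of N N 0] farN by simp
    moreover have "l pi 0 N = l (pi / 2) 0 N" using corner[of 0 N "pi / 2"] farN by simp
    moreover have "l (3 / 2 * pi) 0 0 = l pi 0 0"
    proof -
      have e: "pi + pi / 2 = 3 / 2 * pi" by simp
      show ?thesis using corner[of 0 0 pi] farN unfolding e by simp
    qed
    \<comment> \<open>Going once around the square returns to the first corner with the outward
      angle advanced by a full turn; this is the only contribution to the winding.\<close>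
    moreover have "l (3 / 2 * pi) 0 0 = l (- pi / 2) 0 0 + 3 * k"
    proof -
      have e: "- pi / 2 + 2 * pi = 3 / 2 * pi" by simp
      show ?thesis using F_turn[of "pt 0 0" "- pi / 2"] unfolding e l_def
        by (simp add: window_lift_add)
    qed
    ultimately show "(\<Sum>a<N. wrap k (lam (Suc a) 0 0 - lam a 0 0) - wrap k (lam (Suc a) N 0 - lam a N 0))
      + (\<Sum>b<N. wrap k (lam N (Suc b) 0 - lam N b 0) - wrap k (lam 0 (Suc b) 0 - lam 0 b 0)) = 3 * k"
      unfolding sum_subtractf sums by linarith
  qed
qed

end

section \<open>Cumulative mass by angle\<close>

definition ang :: "real^2 \<Rightarrow> real" where
  "ang x = Arg (Complex (x $ 1) (x $ 2))"

section \<open>Polar angles, sectors and half-planes\<close>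

lemma dir_inner_dir: "dir a \<bullet> dir b = cos (a - b)"
  by (simp add: dir_def inner_vec_def sum_2 cos_diff)

lemma norm_dir_ang: "norm x *\<^sub>R dir (ang x) = x"
proof -
  define z where "z = Complex (x $ 1) (x $ 2)"
  have n: "cmod z = norm x" by (simp add: z_def cmod_def norm_vec_def L2_set_def sum_2)
  have "rcis (cmod z) (Arg z) = z" by (rule rcis_cmod_Arg)
  then have "cmod z * cos (Arg z) = x $ 1" "cmod z * sin (Arg z) = x $ 2"
    by (metis Re_rcis z_def complex.sel(1), metis Im_rcis z_def complex.sel(2))
  then show ?thesis
    by (simp add: vec_eq_iff forall_2 dir_def ang_def z_def[symmetric] n)
qed

lemma dir_eqD:
  assumes "dir a = dir b"
  shows "\<exists>n::int. a = b + 2 * pi * of_int n"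
proof -
  have "dir a $ 1 = dir b $ 1" "dir a $ 2 = dir b $ 2" using assms by simp_all
  then show ?thesis by (simp add: dir_def sin_cos_eq_iff[symmetric])
qed

lemma dir_add_turns: "dir (a + 2 * pi * of_int n) = dir a"
proof -
  have "sin (a + 2 * pi * of_int n) = sin a \<and> cos (a + 2 * pi * of_int n) = cos a"
    by (subst sin_cos_eq_iff) blast
  then show ?thesis by (simp add: dir_def)
qed

lemma mem_sector_iff:
  assumes "x \<noteq> P"
  shows "x \<in> sector P a b \<longleftrightarrow> (\<exists>n::int. a \<le> ang (x - P) + 2 * pi * of_int n \<and> ang (x - P) + 2 * pi * of_int n \<le> b)"
proof
  assume "x \<in> sector P a b"
  then obtain t s where ts: "a \<le> t" "t \<le> b" "0 \<le> s" "x = P + s *\<^sub>R dir t"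
    by (auto simp: sector_def ray_def)
  then have s: "norm (x - P) = s" by (simp add: norm_dir)
  then have "s *\<^sub>R dir t = s *\<^sub>R dir (ang (x - P))"
    using norm_dir_ang[of "x - P"] ts(4) by (metis add_diff_cancel_left')
  moreover have "s \<noteq> 0" using s assms by auto
  ultimately have "dir t = dir (ang (x - P))" by simp
  then show "\<exists>n::int. a \<le> ang (x - P) + 2 * pi * of_int n \<and> ang (x - P) + 2 * pi * of_int n \<le> b"
  proof -
    obtain n :: int where "t = ang (x - P) + 2 * pi * of_int n"
      using dir_eqD \<open>dir t = dir (ang (x - P))\<close> by blast
    then show ?thesis using ts(1,2) by blast
  qed
next
  assume "\<exists>n::int. a \<le> ang (x - P) + 2 * pi * of_int n \<and> ang (x - P) + 2 * pi * of_int n \<le> b"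
  then obtain n :: int where n: "ang (x - P) + 2 * pi * of_int n \<in> {a..b}" by auto
  have "x = P + norm (x - P) *\<^sub>R dir (ang (x - P) + 2 * pi * of_int n)"
    by (simp add: dir_add_turns norm_dir_ang)
  then have "x \<in> ray P (ang (x - P) + 2 * pi * of_int n)"
    unfolding ray_def using norm_ge_zero by blast
  then show "x \<in> sector P a b" using n by (auto simp: sector_def)
qed

lemma sector_eq_halfplanes:
  assumes "a < b" "b \<le> a + pi"
  shows "sector P a b = {x. 0 \<le> (x - P) \<bullet> dir (a + pi / 2)} \<inter> {x. 0 \<le> (x - P) \<bullet> dir (b - pi / 2)}"
    (is "_ = ?H")
proof (rule set_eqI)
  have cs: "cos (t - (a + pi / 2)) = sin (t - a)" "cos (t - (b - pi / 2)) = sin (b - t)" for t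
    by (simp_all add: cos_diff sin_diff sin_add cos_add)
  fix x
  show "x \<in> sector P a b \<longleftrightarrow> x \<in> ?H"
  proof (cases "x = P")
    case True
    have "P + 0 *\<^sub>R dir a \<in> ray P a" unfolding ray_def by blast
    then show ?thesis using True assms by (auto simp: sector_def)
  next
    case False
    define r where "r = norm (x - P)"
    have r: "r > 0" using False by (simp add: r_def)
    have x: "x - P = r *\<^sub>R dir (ang (x - P) + 2 * pi * of_int n)" for n :: int
      by (simp add: dir_add_turns norm_dir_ang r_def)
    have H: "x \<in> ?H \<longleftrightarrow> 0 \<le> sin (ang (x - P) + 2 * pi * of_int n - a)
        \<and> 0 \<le> sin (b - (ang (x - P) + 2 * pi * of_int n))" for n :: int
    proof -
      have "(x - P) \<bullet> dir u = r * cos (ang (x - P) + 2 * pi * of_int n - u)" for u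
        using x[of n] by (metis dir_inner_dir inner_scaleR_left)
      then show ?thesis using r by (simp add: cs zero_le_mult_iff)
    qed
    show ?thesis
    proof
      assume "x \<in> sector P a b"
      then obtain n :: int where "a \<le> ang (x - P) + 2 * pi * of_int n"
        "ang (x - P) + 2 * pi * of_int n \<le> b"
        using mem_sector_iff[OF False] by blast
      then show "x \<in> ?H" using assms by (subst H[of n]) (auto intro!: sin_ge_zero)
    next
      assume xH: "x \<in> ?H"
      define n where "n = - \<lfloor>(ang (x - P) - a) / (2 * pi)\<rfloor>"
      \<comment> \<open>With \<open>t\<close> normalised to \<open>[a, a + 2 * pi)\<close>, the
        first half-plane forces \<open>t \<le> a + pi\<close>. Then \<open>t > b\<close> would give
        \<open>0 < t - b < pi\<close>, violating the second.\<close>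
      define t where "t = ang (x - P) + 2 * pi * of_int n"
      have "of_int (- n) \<le> (ang (x - P) - a) / (2 * pi)" "(ang (x - P) - a) / (2 * pi) < of_int (- n) + 1"
        unfolding n_def by simp_all
      then have t: "a \<le> t" "t < a + 2 * pi" by (simp_all add: t_def field_simps)
      have sins: "0 \<le> sin (t - a)" "0 \<le> sin (b - t)" using xH H[of n] by (simp_all add: t_def)
      have "t \<le> a + pi"
        using sin_lt_zero[of "t - a"] sins(1) t(2) by argo
      moreover have "t \<le> b"
      proof (rule ccontr)
        assume "\<not> t \<le> b"
        then have "0 < sin (t - b)" using \<open>t \<le> a + pi\<close> assms by (intro sin_gt_zero) auto
        then show False using sins(2) sin_minus[of "t - b"] by simp
      qed
      ultimately show "x \<in> sector P a b" using mem_sector_iff[OF False] t(1) t_def by blast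
    qed
  qed
qed

lemma convex_sector:
  assumes "a < b" "b \<le> a + pi"
  shows "convex (sector P a b)"
proof -
  have "convex {x. 0 \<le> (x - P) \<bullet> u}" for u :: "real^2"
  proof -
    have "{x. 0 \<le> (x - P) \<bullet> u} = {x. u \<bullet> P \<le> u \<bullet> x}"
      by (simp add: inner_diff_left inner_diff_right inner_commute)
    then show ?thesis using convex_halfspace_ge[of "u \<bullet> P" u] by simp
  qed
  then show ?thesis unfolding sector_eq_halfplanes[OF assms] by (intro convex_Int)
qed

lemma ang_measurable: "ang \<in> borel_measurable borel"
proof -
  let ?N = "\<real>\<^sub>\<le>\<^sub>0 :: complex set"
  \<comment> \<open>\<open>Arg\<close> is continuous off the nonpositive axis and equals
    \<open>pi\<close> on the negative one. At 0 both indicators vanish, matching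
    \<open>Arg 0 = 0\<close>.\<close>
  have eq: "Arg z = indicator (- ?N) z *\<^sub>R Arg z + indicator (?N - {0}) z *\<^sub>R pi" for z
  proof (cases "z = 0")
    case True
    then show ?thesis by (simp add: Arg_zero)
  next
    case False
    then show ?thesis
      by (auto simp: indicator_def complex_nonpos_Reals_iff Arg_eq_pi complex_eq_iff)
  qed
  have "(\<lambda>z. indicator (- ?N) z *\<^sub>R Arg z) \<in> borel_measurable borel"
    by (intro borel_measurable_continuous_on_indicator continuous_on_Arg) auto
  moreover have "(\<lambda>z. indicator (?N - {0}) z *\<^sub>R pi) \<in> borel_measurable borel"
    by (intro borel_measurable_scaleR borel_measurable_indicator) auto
  ultimately have "Arg \<in> borel_measurable borel"
    by (subst eq[abs_def]) (rule borel_measurable_add)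
  moreover have "(\<lambda>x::real^2. Complex (x $ 1) (x $ 2)) \<in> borel_measurable borel"
    by (intro borel_measurable_continuous_onI) (simp add: Complex_eq, intro continuous_intros)
  ultimately show ?thesis
    unfolding ang_def[abs_def] by (rule measurable_compose[rotated])
qed

text \<open>Integrating \<open>turn P a\<close> gives a cumulative mass by polar angle at \<open>P\<close>, already lifted to the real
  line. Since \<open>Arg\<close> takes values in \<open>{-pi<..pi}\<close>, it vanishes at \<open>a = pi\<close>.\<close>

definition turn :: "real^2 \<Rightarrow> real \<Rightarrow> real^2 \<Rightarrow> int" where
  "turn P a x = \<lfloor>(a - ang (x - P)) / (2 * pi)\<rfloor>"

lemma turn_measurable: "(\<lambda>x. real_of_int (turn P a x)) \<in> borel_measurable borel"
proof -
  have "(\<lambda>x. ang (x - P)) \<in> borel_measurable borel"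
    by (rule measurable_compose[OF _ ang_measurable]) simp
  then show ?thesis unfolding turn_def by (intro measurable_compose[OF _ borel_measurable_real_floor]) simp
qed

lemma turn_bound: "\<bar>real_of_int (turn P a x)\<bar> \<le> \<bar>a\<bar> + 2"
proof -
  have ang: "\<bar>ang (x - P)\<bar> \<le> pi" using Arg_bounded unfolding ang_def by (simp add: abs_le_iff less_imp_le minus_le_iff)
  have "\<bar>(a - ang (x - P)) / (2 * pi)\<bar> \<le> \<bar>a\<bar> + 1"
  proof -
    have "\<bar>a - ang (x - P)\<bar> \<le> \<bar>a\<bar> + pi" using ang by linarith
    also have "\<dots> \<le> (\<bar>a\<bar> + 1) * (2 * pi)"
    proof -
      have "\<bar>a\<bar> * 1 \<le> \<bar>a\<bar> * (2 * pi)" using pi_gt3 by (intro mult_left_mono) auto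
      then show ?thesis by (simp add: distrib_right) (use pi_gt_zero in linarith)
    qed
    finally show ?thesis by (simp add: abs_divide divide_le_eq)
  qed
  then show ?thesis unfolding turn_def by linarith
qed

text \<open>Confines the jumps of \<open>turn P a\<close> to the line through \<open>P\<close> in
  direction \<open>a\<close>, a null set for a planar mass.\<close>

lemma inner_dir_perp_eq_0:
  assumes "(a - ang (x - P)) / (2 * pi) \<in> \<int>"
  shows "(x - P) \<bullet> dir (a + pi / 2) = 0"
proof -
  obtain n :: int where "(a - ang (x - P)) / (2 * pi) = of_int n" using assms Ints_cases by blast
  then have "a = ang (x - P) + 2 * pi * of_int n" by (simp add: field_simps)
  then have "dir a = dir (ang (x - P))" by (simp add: dir_add_turns)
  then have "x - P = norm (x - P) *\<^sub>R dir a" by (simp add: norm_dir_ang)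
  then have "(x - P) \<bullet> dir (a + pi / 2) = norm (x - P) * (dir a \<bullet> dir (a + pi / 2))"
    by (metis inner_scaleR_left)
  then show ?thesis by (simp add: dir_inner_dir)
qed

text \<open>The two excluded lines through \<open>P\<close> contain the jumps of the floor and the
  branch cut of \<open>Arg\<close>. Elsewhere the turn count is eventually constant.\<close>

lemma turn_tendsto:
  assumes "X \<longlonglongrightarrow> P" "f \<longlonglongrightarrow> a"
    and "(x - P) \<bullet> dir (a + pi / 2) \<noteq> 0" "(x - P) \<bullet> dir (pi / 2) \<noteq> 0"
  shows "(\<lambda>n. real_of_int (turn (X n) (f n) x)) \<longlonglongrightarrow> real_of_int (turn P a x)"
proof -
  have "(x - P) $ 2 \<noteq> 0" using assms(4) by (simp add: dir_def inner_vec_def sum_2)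
  then have "Complex ((x - P) $ 1) ((x - P) $ 2) \<notin> \<real>\<^sub>\<le>\<^sub>0" by (simp add: complex_nonpos_Reals_iff)
  moreover have "(\<lambda>n. Complex ((x - X n) $ 1) ((x - X n) $ 2)) \<longlonglongrightarrow> Complex ((x - P) $ 1) ((x - P) $ 2)"
    by (intro tendsto_Complex tendsto_vec_nth tendsto_diff assms tendsto_const)
  ultimately have "(\<lambda>n. ang (x - X n)) \<longlonglongrightarrow> ang (x - P)"
    unfolding ang_def by (intro tendsto_Arg)
  then have "(\<lambda>n. (f n - ang (x - X n)) / (2 * pi)) \<longlonglongrightarrow> (a - ang (x - P)) / (2 * pi)"
    by (intro tendsto_intros assms) auto
  then have "\<forall>\<^sub>F n in sequentially. turn (X n) (f n) x = turn P a x"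
    unfolding turn_def by (rule eventually_floor_eq) (use inner_dir_perp_eq_0 assms(3) in blast)
  then show ?thesis by (intro tendsto_eventually) (auto elim: eventually_mono)
qed

lemma floor_diff_eq_indicator:
  fixes u v :: real
  assumes "u \<notin> \<int>" "u \<le> v" "v \<le> u + 1"
  shows "\<lfloor>v\<rfloor> - \<lfloor>u\<rfloor> = (if \<exists>n::int. u \<le> of_int n \<and> of_int n \<le> v then 1 else 0)"
proof (cases "\<exists>n::int. u \<le> of_int n \<and> of_int n \<le> v")
  case True
  then obtain n :: int where n: "u \<le> of_int n" "of_int n \<le> v" by blast
  have "u \<noteq> of_int n" using assms(1) by auto
  then have "\<lfloor>u\<rfloor> < n" "n \<le> \<lfloor>v\<rfloor>" using n by (auto simp: le_floor_iff floor_less_iff)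
  moreover have "\<lfloor>v\<rfloor> \<le> \<lfloor>u\<rfloor> + 1" using floor_mono[OF assms(3)] by simp
  ultimately show ?thesis using True by simp
next
  case False
  have "\<lfloor>u\<rfloor> \<le> \<lfloor>v\<rfloor>" using assms floor_mono by blast
  moreover have "\<not> \<lfloor>u\<rfloor> < \<lfloor>v\<rfloor>"
  proof
    assume "\<lfloor>u\<rfloor> < \<lfloor>v\<rfloor>"
    then have "u \<le> of_int \<lfloor>v\<rfloor>" by linarith
    then show False using False of_int_floor_le by blast
  qed
  ultimately show ?thesis using False by simp
qed

section \<open>Cumulative mass of a planar mass\<close>

locale planar =
  fixes \<mu> :: "(real^2) measure"
  assumes planar: "planar_mass \<mu>"
begin

sublocale prob_space \<mu>
  using planar planar_mass_def by blast

lemma sets_eq: "sets \<mu> = sets borel"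
  using planar planar_mass_def by blast

lemma space_eq: "space \<mu> = UNIV"
  using sets_eq_imp_space_eq[OF sets_eq] by simp

lemma AE_off_line:
  assumes "u \<noteq> 0"
  shows "AE x in \<mu>. (x - P) \<bullet> u \<noteq> 0"
proof -
  define L where "L = {x. u \<bullet> x = u \<bullet> P}"
  have "affine L" "aff_dim L = 1" using assms by (simp_all add: L_def affine_hyperplane)
  then have "measure \<mu> L = 0" using planar planar_mass_def by blast
  moreover have "L \<in> sets \<mu>" unfolding sets_eq L_def by (intro borel_closed closed_hyperplane)
  ultimately have "L \<in> null_sets \<mu>" by (simp add: emeasure_eq_measure null_setsI)
  then show ?thesis
    by (rule AE_I') (auto simp: L_def inner_diff_left inner_diff_right inner_commute)
qed

definition cmass :: "real^2 \<Rightarrow> real \<Rightarrow> real" where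
  "cmass P a = (\<integral>x. real_of_int (turn P a x) \<partial>\<mu>)"

lemma turn_measurable': "(\<lambda>x. real_of_int (turn P a x)) \<in> borel_measurable \<mu>"
  using turn_measurable measurable_cong_sets[OF sets_eq refl] by blast

lemma turn_integrable: "integrable \<mu> (\<lambda>x. real_of_int (turn P a x))"
  by (rule integrable_const_bound[where B = "\<bar>a\<bar> + 2"]) (auto simp: turn_bound turn_measurable')

lemma dir_nonzero: "dir a \<noteq> 0"
  using norm_dir[of a] by auto

text \<open>Dominated convergence, with the bound from \<open>turn_bound\<close>, gives joint
  continuity: in the point for the grid argument, in the angle for the existence of rays.\<close>

lemma cmass_tendsto:
  assumes "X \<longlonglongrightarrow> P" "f \<longlonglongrightarrow> a"
  shows "(\<lambda>n. cmass (X n) (f n)) \<longlonglongrightarrow> cmass P a"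
proof -
  obtain K where K: "\<And>n. \<bar>f n\<bar> \<le> K"
    using convergent_imp_Bseq[of f] assms(2) by (auto simp: convergent_def Bseq_def)
  show ?thesis unfolding cmass_def
  proof (rule integral_dominated_convergence[where w = "\<lambda>_. K + 2"])
    show "AE x in \<mu>. (\<lambda>n. real_of_int (turn (X n) (f n) x)) \<longlonglongrightarrow> real_of_int (turn P a x)"
      using AE_off_line[OF dir_nonzero, of P "a + pi / 2"] AE_off_line[OF dir_nonzero, of P "pi / 2"]
      by eventually_elim (rule turn_tendsto[OF assms])
    show "AE x in \<mu>. norm (real_of_int (turn (X n) (f n) x)) \<le> K + 2" for n
      using turn_bound K[of n] by (intro AE_I2) (smt (verit) real_norm_def)
  qed (auto simp: turn_measurable')
qed

lemma cmass_mono: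
  assumes "a \<le> b"
  shows "cmass P a \<le> cmass P b"
  unfolding cmass_def
  by (intro integral_mono turn_integrable)
    (simp add: turn_def floor_mono divide_right_mono assms)

lemma cmass_turn: "cmass P (a + 2 * pi) = cmass P a + 1"
proof -
  have "turn P (a + 2 * pi) x = turn P a x + 1" for x
  proof -
    have "(a + 2 * pi - ang (x - P)) / (2 * pi) = (a - ang (x - P)) / (2 * pi) + 1"
      by (simp add: field_simps)
    then show ?thesis by (simp add: turn_def)
  qed
  then show ?thesis using turn_integrable by (simp add: cmass_def prob_space)
qed

lemma sector_sets:
  assumes "a \<le> b"
  shows "sector P a b \<in> sets borel"
proof -
  have m: "(\<lambda>x. ang (x - P)) \<in> borel_measurable borel"
    by (rule measurable_compose[OF _ ang_measurable]) simp
  have "P + 0 *\<^sub>R dir a \<in> ray P a" unfolding ray_def by blast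
  then have "P \<in> sector P a b" using assms by (auto simp: sector_def)
  then have "sector P a b = {P} \<union> (\<Union>n::int. {x. a \<le> ang (x - P) + 2 * pi * of_int n} \<inter> {x. ang (x - P) + 2 * pi * of_int n \<le> b} - {P})"
    using mem_sector_iff[of _ P a b] by blast
  also have "\<dots> \<in> sets borel"
    using m by measurable
  finally show ?thesis .
qed

text \<open>Off the line through \<open>P\<close> in direction \<open>a\<close>, the difference of
  the two turn counts is the number of lifts of the polar angle of \<open>x\<close> in
  \<open>[a, b]\<close>, which is the indicator of the sector.\<close>

lemma measure_sector:
  assumes "a \<le> b" "b \<le> a + 2 * pi"
  shows "measure \<mu> (sector P a b) = cmass P b - cmass P a"
proof -
  have "AE x in \<mu>. indicator (sector P a b) x = real_of_int (turn P b x) - real_of_int (turn P a x)"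
    using AE_off_line[OF dir_nonzero, of P "a + pi / 2"]
  proof eventually_elim
    case (elim x)
    define u v where "u = (a - ang (x - P)) / (2 * pi)" and "v = (b - ang (x - P)) / (2 * pi)"
    have "u \<notin> \<int>" using elim inner_dir_perp_eq_0 u_def by blast
    moreover have "u \<le> v" using assms by (simp add: u_def v_def divide_right_mono)
    moreover have "v \<le> u + 1" using assms by (simp add: u_def v_def field_simps)
    ultimately have "\<lfloor>v\<rfloor> - \<lfloor>u\<rfloor> = (if \<exists>n::int. u \<le> of_int n \<and> of_int n \<le> v then 1 else 0)"
      by (rule floor_diff_eq_indicator)
    moreover have "x \<in> sector P a b \<longleftrightarrow> (\<exists>n::int. u \<le> of_int n \<and> of_int n \<le> v)"
    proof -
      have "x \<noteq> P" using elim by auto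
      then show ?thesis unfolding mem_sector_iff[OF \<open>x \<noteq> P\<close>]
        by (simp add: u_def v_def field_simps)
    qed
    ultimately show ?case
      unfolding turn_def u_def[symmetric] v_def[symmetric] of_int_diff[symmetric] by simp
  qed
  then have "(\<integral>x. indicator (sector P a b) x \<partial>\<mu>)
      = (\<integral>x. real_of_int (turn P b x) - real_of_int (turn P a x) \<partial>\<mu>)"
    using sector_sets[OF assms(1)] turn_measurable' sets_eq by (intro integral_cong_AE) auto
  also have "\<dots> = cmass P b - cmass P a"
    unfolding cmass_def by (intro Bochner_Integration.integral_diff turn_integrable)
  finally show ?thesis by (simp add: space_eq)
qed

text \<open>The half-plane at \<open>P\<close> facing \<psi> lies outside the ball of radius
  \<open>R\<close> about the origin, and the mass outside large balls tends to zero.\<close>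

lemma far_mass_small:
  assumes "c > 0"
  shows "\<exists>R>0. \<forall>P \<psi>. R \<le> P \<bullet> dir \<psi> \<longrightarrow> cmass P (\<psi> + pi / 2) - cmass P (\<psi> - pi / 2) \<le> c"
proof -
  define A where "A n = {x::real^2. real n \<le> norm x}" for n :: nat
  have A: "A n \<in> sets \<mu>" for n
    unfolding A_def sets_eq by (intro borel_closed closed_Collect_le continuous_intros)
  have "(\<lambda>n. measure \<mu> (A n)) \<longlonglongrightarrow> measure \<mu> (\<Inter>n. A n)"
    by (rule finite_Lim_measure_decseq) (use A in \<open>auto simp: decseq_def A_def\<close>)
  moreover have "(\<Inter>n. A n) = {}"
  proof -
    have "x \<notin> (\<Inter>n. A n)" for x
      using reals_Archimedean2[of "norm x"] by (auto simp: A_def not_le)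
    then show ?thesis by blast
  qed
  ultimately have "(\<lambda>n. measure \<mu> (A n)) \<longlonglongrightarrow> 0" by simp
  then have "\<forall>\<^sub>F n in sequentially. measure \<mu> (A n) < c" using assms order_tendstoD(2) by blast
  then have "\<forall>\<^sub>F n in sequentially. measure \<mu> (A n) < c \<and> 0 < n"
    using eventually_gt_at_top by (rule eventually_conj)
  then obtain n where n: "measure \<mu> (A n) < c" "n > 0"
    by (auto dest: eventually_happens)
  show ?thesis
  proof (intro exI[of _ "real n"] conjI allI impI)
    fix P \<psi> assume far: "real n \<le> P \<bullet> dir \<psi>"
    have "sector P (\<psi> - pi / 2) (\<psi> + pi / 2) \<subseteq> A n"
    proof
      fix x assume "x \<in> sector P (\<psi> - pi / 2) (\<psi> + pi / 2)"
      then obtain t s where ts: "\<psi> - pi / 2 \<le> t" "t \<le> \<psi> + pi / 2" "0 \<le> s" "x = P + s *\<^sub>R dir t"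
        by (auto simp: sector_def ray_def)
      have "0 \<le> cos (t - \<psi>)" using ts by (intro cos_ge_zero) auto
      then have "real n \<le> x \<bullet> dir \<psi>"
        using ts far by (simp add: inner_add_left dir_inner_dir add_increasing2)
      also have "\<dots> \<le> norm x * norm (dir \<psi>)" by (rule norm_cauchy_schwarz)
      finally show "x \<in> A n" by (simp add: A_def norm_dir)
    qed
    then have "measure \<mu> (sector P (\<psi> - pi / 2) (\<psi> + pi / 2)) \<le> measure \<mu> (A n)"
      by (intro finite_measure_mono A)
    then show "cmass P (\<psi> + pi / 2) - cmass P (\<psi> - pi / 2) \<le> c"
      using n measure_sector[of "\<psi> - pi / 2" "\<psi> + pi / 2" P] by simp
  qed (use n in auto)
qed

end

section \<open>Existence of the rays\<close>

text \<open>If \<open>mx t\<close> is the largest angle at which \<open>f\<close> equals \<open>t\<close>, then \<open>mx t\<close> itself may violate the bound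
  on \<open>\<theta> (j + k + 1)\<close> when \<open>f\<close> has plateaus. The minimum of \<open>mx t\<close> and \<open>mx (t - k - 1) + pi\<close> works because
  \<open>2 * (k + 1) \<le> 3 * k\<close>.\<close>

lemma exists_spiral_angles:
  fixes f :: "real \<Rightarrow> real" and k :: int
  assumes k2: "k \<ge> 2"
    and mono: "\<And>a b. a \<le> b \<Longrightarrow> f a \<le> f b"
    and turns: "\<And>a m. f (a + 2 * pi * of_int m) = f a + 3 * of_int k * of_int m"
    and cont: "continuous_on UNIV f"
    and good: "\<And>j a. y + of_int j < f a \<Longrightarrow> y + of_int j + of_int k + 1 \<le> f (a + pi)"
  shows "\<exists>\<theta> :: int \<Rightarrow> real. \<forall>j. f (\<theta> j) = y + of_int j \<and> \<theta> (j + 3 * k) = \<theta> j + 2 * pi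
    \<and> \<theta> (j + k + 1) \<le> \<theta> j + pi"
proof -
  have large: "\<exists>a. t \<le> f a" for t
  proof -
    obtain n where n: "t - f 0 \<le> real n" using real_arch_simple by blast
    have "real n * 1 \<le> real n * (3 * of_int k)" using k2 by (intro mult_left_mono) auto
    then have "t \<le> f (0 + 2 * pi * of_int (int n))"
      using n turns[of 0 "int n"] by (simp add: mult.commute)
    then show ?thesis by blast
  qed
  have small: "\<exists>a. f a \<le> t" for t
  proof -
    obtain n where n: "f 0 - t \<le> real n" using real_arch_simple by blast
    have "real n * 1 \<le> real n * (3 * of_int k)" using k2 by (intro mult_left_mono) auto
    then have "f (0 + 2 * pi * of_int (- int n)) \<le> t"
      using n turns[of 0 "- int n"] by (simp add: mult.commute)
    then show ?thesis by blast
  qed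
  have "\<exists>a. f a = t \<and> (\<forall>b>a. t < f b)" for t
  proof -
    define S where "S = {a. f a \<le> t}"
    obtain a0 where a0: "f a0 \<le> t" using small by blast
    obtain b0 where b0: "t + 1 \<le> f b0" using large by blast
    have "a \<le> b0" if "a \<in> S" for a
      using that b0 mono[of b0 a] by (fastforce simp: S_def)
    then have bdd: "bdd_above S" by (rule bdd_aboveI)
    have "closed S" unfolding S_def by (intro closed_Collect_le cont continuous_intros)
    then have mem: "Sup S \<in> S" using a0 bdd by (intro closed_contains_Sup) (auto simp: S_def)
    have "a0 \<le> b0" using a0 b0 mono[of b0 a0] by fastforce
    then obtain c where "f c = t"
      using IVT'[of f a0 t b0] a0 b0 cont by (auto intro: continuous_on_subset)
    then have "c \<le> Sup S" using bdd by (intro cSup_upper) (auto simp: S_def)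
    then have "t \<le> f (Sup S)" using mono \<open>f c = t\<close> by blast
    then have "f (Sup S) = t" using mem by (simp add: S_def)
    moreover have "t < f b" if "Sup S < b" for b
      using that cSup_upper[OF _ bdd, of b] by (fastforce simp: S_def)
    ultimately show ?thesis by blast
  qed
  then obtain mx where mx: "\<And>t. f (mx t) = t" "\<And>t b. mx t < b \<Longrightarrow> t < f b" by metis
  have mx_turn: "mx (t + 3 * of_int k) = mx t + 2 * pi" for t
  proof (rule ccontr)
    assume ne: "mx (t + 3 * of_int k) \<noteq> mx t + 2 * pi"
    show False
    proof (cases "mx (t + 3 * of_int k) < mx t + 2 * pi")
      case True
      then show False using mx(2)[OF True] turns[of "mx t" 1] mx(1) by simp
    next
      case False
      then have "mx t < mx (t + 3 * of_int k) - 2 * pi" using ne by simp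
      then have "t < f (mx (t + 3 * of_int k) - 2 * pi)" by (rule mx(2))
      then show False using turns[of "mx (t + 3 * of_int k) - 2 * pi" 1] mx(1) by simp
    qed
  qed
  have mx_mono: "mx s \<le> mx t" if "s \<le> t" for s t
    using that mx(1)[of s] mx(2)[of t "mx s"] by fastforce
  \<comment> \<open>\<open>good\<close> applies only to angles strictly beyond \<open>mx t\<close>;
    continuity carries its bound to \<open>mx t\<close> itself.\<close>
  have reach: "t + of_int k + 1 \<le> f (mx t + pi)" if t: "t = y + of_int j" for t j
  proof (rule ccontr)
    assume "\<not> ?thesis"
    then have "f (mx t + pi) < t + of_int k + 1" by simp
    moreover have "open {a. f a < t + of_int k + 1}"
      by (intro open_Collect_less cont continuous_intros)
    ultimately obtain d where d: "d > 0" "\<And>a. dist a (mx t + pi) < d \<Longrightarrow> f a < t + of_int k + 1"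
      unfolding open_dist by blast
    have "t < f (mx t + d / 2)" using d by (intro mx(2)) simp
    then have "t + of_int k + 1 \<le> f (mx t + d / 2 + pi)" using good t by blast
    moreover have "f (mx t + d / 2 + pi) < t + of_int k + 1"
      using d by (intro d(2)) (simp add: dist_real_def)
    ultimately show False by simp
  qed
  define \<theta> where "\<theta> j = min (mx (y + of_int j)) (mx (y + of_int (j - k - 1)) + pi)" for j
  show ?thesis
  proof (intro exI[of _ \<theta>] allI conjI)
    fix j
    have "y + of_int j \<le> f (mx (y + of_int (j - k - 1)) + pi)"
      using reach[of "y + of_int (j - k - 1)" "j - k - 1"] by simp
    then have "y + of_int j \<le> f (\<theta> j)" using mx(1) by (simp add: \<theta>_def min_def)
    moreover have "f (\<theta> j) \<le> y + of_int j"
      using mono[of "\<theta> j" "mx (y + of_int j)"] mx(1) by (simp add: \<theta>_def)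
    ultimately show "f (\<theta> j) = y + of_int j" by simp
    have "mx (y + of_int (i + 3 * k)) = mx (y + of_int i) + 2 * pi" for i
      using mx_turn[of "y + of_int i"] by (simp add: add.assoc)
    moreover have "j + 3 * k - k - 1 = j - k - 1 + 3 * k" by simp
    ultimately show "\<theta> (j + 3 * k) = \<theta> j + 2 * pi" unfolding \<theta>_def by (simp only: min_def) simp
    \<comment> \<open>\<open>\<theta> j + pi\<close> is the minimum of
      \<open>mx (y + j) + pi\<close> and \<open>mx (y + j - k - 1) + 2 * pi\<close>. The first
      bounds \<open>\<theta> (j + k + 1)\<close> by definition, the second by monotonicity and one
      full turn.\<close>
    have "mx (y + of_int (j + k + 1)) \<le> mx (y + of_int (j - k - 1) + 3 * of_int k)"
    proof (rule mx_mono)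
      have "real_of_int (j + k + 1) \<le> real_of_int (j - k - 1 + 3 * k)" using k2 by linarith
      then show "y + of_int (j + k + 1) \<le> y + of_int (j - k - 1) + 3 * of_int k" by simp
    qed
    then have "mx (y + of_int (j + k + 1)) \<le> mx (y + of_int (j - k - 1)) + 2 * pi"
      unfolding mx_turn .
    moreover have "j + k + 1 - k - 1 = j" by simp
    ultimately show "\<theta> (j + k + 1) \<le> \<theta> j + pi"
      unfolding \<theta>_def by (simp add: min_def)
  qed
qed

section \<open>Assembly of the spiral equicovering\<close>

theorem theorem1:
  fixes k :: nat and \<mu> :: "(real^2) measure"
  assumes "k \<ge> 2" and "planar_mass \<mu>"
  shows "\<exists>P \<theta>. ccw_angles (3 * k) \<theta>
    \<and> (\<forall>j. measure \<mu> (spiral_V P \<theta> j) = 1 / real (3 * k))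
    \<and> (\<forall>j. spiral_angle \<theta> (k + 1) j \<le> pi)
    \<and> convex_spiral_equicovering \<mu> (3 * k) (k + 1) P \<theta>"
proof -
  interpret planar \<mu> using assms(2) by unfold_locales
  define F where "F P a = 3 * real k * cmass P a" for P a
  have F_mono: "F P a \<le> F P b" if "a \<le> b" for P a b
    using cmass_mono[OF that] by (simp add: F_def mult_left_mono)
  interpret turning_mass F "int k"
  proof
    show "2 \<le> int k" using assms(1) by simp
    show "F P a \<le> F P b" if "a \<le> b" for P a b by (rule F_mono[OF that])
    show "F P (a + 2 * pi) = F P a + 3 * real_of_int (int k)" for P a
      by (simp add: F_def cmass_turn distrib_left)
    show "continuous_on UNIV (\<lambda>P. F P a)" for a
      unfolding F_def continuous_on_sequentially comp_def
      by (auto intro!: tendsto_mult cmass_tendsto)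
    \<comment> \<open>Scaling by \<open>3 * k\<close> turns \<open>1 / (24 * k)\<close> into the 1/8
      of \<open>F_far\<close>.\<close>
    obtain R where "R > 0"
      "\<And>P \<psi>. R \<le> P \<bullet> dir \<psi> \<Longrightarrow> cmass P (\<psi> + pi / 2) - cmass P (\<psi> - pi / 2) \<le> 1 / (24 * real k)"
      using far_mass_small[of "1 / (24 * real k)"] assms(1) by auto
    then show "\<exists>R>0. \<forall>P \<psi>. R \<le> P \<bullet> dir \<psi> \<longrightarrow> F P (\<psi> + pi / 2) - F P (\<psi> - pi / 2) \<le> 1 / 8"
      using assms(1) by (intro exI[of _ R]) (auto simp: F_def field_simps)
  qed
  obtain P y where not_bad: "\<And>j::int. \<not> bad P (y + of_int j)" using exists_not_bad by blast
  have cont: "continuous_on UNIV (F P)"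
    unfolding F_def continuous_on_sequentially comp_def
    by (auto intro!: tendsto_mult cmass_tendsto)
  have "\<exists>\<theta> :: int \<Rightarrow> real. \<forall>j. F P (\<theta> j) = y + of_int j \<and> \<theta> (j + 3 * int k) = \<theta> j + 2 * pi
    \<and> \<theta> (j + int k + 1) \<le> \<theta> j + pi"
  proof (rule exists_spiral_angles[OF k2 F_mono F_turns cont])
    show "y + of_int j + of_int (int k) + 1 \<le> F P (a + pi)" if "y + of_int j < F P a" for j a
      using not_bad[of j] that unfolding bad_def not_ex by (metis linorder_not_less)
  qed
  then obtain \<phi> :: "int \<Rightarrow> real" where \<phi>: "\<And>j. F P (\<phi> j) = y + of_int j"
    "\<And>j. \<phi> (j + 3 * int k) = \<phi> j + 2 * pi" "\<And>j. \<phi> (j + int k + 1) \<le> \<phi> j + pi"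
    by blast
  define \<theta> where "\<theta> j = \<phi> (int j)" for j
  have less: "\<theta> i < \<theta> j" if "i < j" for i j
    using F_mono[of "\<theta> j" "\<theta> i" P] that \<phi>(1) unfolding \<theta>_def by fastforce
  have turn: "\<theta> (j + 3 * k) = \<theta> j + 2 * pi" for j using \<phi>(2)[of "int j"] by (simp add: \<theta>_def)
  have half: "\<theta> (j + (k + 1)) \<le> \<theta> j + pi" for j
  proof -
    have "int (j + (k + 1)) = int j + int k + 1" by simp
    then show ?thesis using \<phi>(3)[of "int j"] by (simp only: \<theta>_def)
  qed
  have ccw: "ccw_angles (3 * k) \<theta>"
    using less turn by (simp add: ccw_angles_def strict_mono_def)
  have mass: "measure \<mu> (spiral_V P \<theta> j) = 1 / real (3 * k)" for j
  proof -
    have "\<theta> (j + 1) \<le> \<theta> j + 2 * pi"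
      using less[of "j + 1" "j + 3 * k"] turn[of j] assms(1) by simp
    then have "measure \<mu> (spiral_V P \<theta> j) = cmass P (\<theta> (j + 1)) - cmass P (\<theta> j)"
      unfolding spiral_V_def using less[of j "j + 1"] by (intro measure_sector) auto
    moreover have "F P (\<theta> (j + 1)) - F P (\<theta> j) = 1" using \<phi>(1) by (simp add: \<theta>_def)
    ultimately have "3 * real k * measure \<mu> (spiral_V P \<theta> j) = 1"
      by (simp add: F_def right_diff_distrib)
    then show ?thesis using assms(1) by (simp add: field_simps)
  qed
  have "convex (spiral_W P \<theta> (k + 1) j)" for j
    using less[of j "j + (k + 1)"] half by (subst spiral_W_eq_sector[OF ccw]) (auto intro: convex_sector)
  then have "convex_spiral_equicovering \<mu> (3 * k) (k + 1) P \<theta>"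
    using ccw mass assms(1) by (simp add: convex_spiral_equicovering_def spiral_equicovering_def)
  moreover have "spiral_angle \<theta> (k + 1) j \<le> pi" for j using half[of j] by (simp add: spiral_angle_def)
  ultimately show ?thesis using ccw mass by blast
qed

end
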